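(* Fix $r\ge0$. Let $h\ge2$ be an integer, $R=\lceil 20h/\log h\rceil$ (with $R>r$), and let $\phi^*$ be the $\mathbb R$-valued function that is (discrete) harmonic in $A_{r,R}:=B_R(o)\setminus B_r(o)$ with boundary conditions $h$ on $\partial B_r(o)$ and $0$ on $\partial B_R(o)$. There exists an absolute constant $C>0$ such that, for every sufficiently large $\beta$ and every $z\notin B_r(o)$, $$\hat\pi_\infty\Big(\phi_z\notin\Big[\phi^*_z-C\frac h{\log h},\,\phi^*_z+C\frac h{\log h}\Big]\;\Big|\;\phi_x=h,\ \forall x\in B_r(o)\Big)\le e^{-\frac15(\beta-C)\frac h{\log h}}.$$
   Context: $\hat\pi_\infty$ is the infinite-volume weak limit, as $M\to\infty$, of the Discrete Gaussian measures on $\phi:V\to\mathbb Z$, $V=\{-M,\dots,M\}^2$, with probabilities proportional to $\exp(-\beta\sum_{x\sim y}|\phi_x-\phi_y|^2)$ (sum over nearest-neighbor pairs of $\mathbb Z^2$ with at least one endpoint in $V$, and $\phi=0$ off $V$); it exists for large $\beta$. $B_s(o)$ is the ball of radius $s$ in $\mathbb Z^2$ around the origin $o$. The function $\phi^*$ is extended to all of $\mathbb Z^2$ by $\phi^*=h$ on $B_r(o)$ and $\phi^*=0$ outside $B_R(o)$.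
   Formalization: The constant C (and the threshold for β) may depend on the fixed r, though not on h, z or β; a C independent of r is impossible, since for r ≥ R−1 and h large the field just outside B_R(o) stays near h while φ* = 0 there. *)

theory Defs
  imports "HOL-Probability.Probability"
begin

type_synonym site = "int \<times> int"
type_synonym config = "site \<Rightarrow> int"

definition adj :: "site \<Rightarrow> site \<Rightarrow> bool" where
  "adj x y \<longleftrightarrow> \<bar>fst x - fst y\<bar> + \<bar>snd x - snd y\<bar> = 1"

text \<open>Closed Euclidean balls, so that the ball of radius 0 is the origin alone.\<close>

definition lball :: "real \<Rightarrow> site set" where
  "lball s = {x. sqrt ((real_of_int (fst x))\<^sup>2 + (real_of_int (snd x))\<^sup>2) \<le> s}"

definition box :: "nat \<Rightarrow> site set" where
  "box M = {- int M..int M} \<times> {- int M..int M}"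

definition box_configs :: "nat \<Rightarrow> config set" where
  "box_configs M = {\<phi>. \<forall>x. x \<notin> box M \<longrightarrow> \<phi> x = 0}"

text \<open>The sum runs over ordered pairs, hence the factor 1/2.\<close>

definition DG_energy :: "nat \<Rightarrow> config \<Rightarrow> real" where
  "DG_energy M \<phi> =
     (\<Sum>(x, y) \<in> {(x, y). adj x y \<and> (x \<in> box M \<or> y \<in> box M)}.
        (real_of_int \<bar>\<phi> x - \<phi> y\<bar>)\<^sup>2) / 2"

definition DG_weight :: "real \<Rightarrow> nat \<Rightarrow> config \<Rightarrow> real" where
  "DG_weight \<beta> M \<phi> = exp (- \<beta> * DG_energy M \<phi>)"

definition DG_partition :: "real \<Rightarrow> nat \<Rightarrow> real" where
  "DG_partition \<beta> M = (\<Sum>\<^sub>\<infinity>\<phi>\<in>box_configs M. DG_weight \<beta> M \<phi>)"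

text \<open>The configurations in the box carry all the mass; the law is transported to the Borel
  sigma-algebra of the product topology on \<^typ>\<open>config\<close>.\<close>

definition DG_box :: "real \<Rightarrow> nat \<Rightarrow> config measure" where
  "DG_box \<beta> M =
     distr (point_measure (box_configs M) (\<lambda>\<phi>. ennreal (DG_weight \<beta> M \<phi> / DG_partition \<beta> M)))
       borel (\<lambda>\<phi>. \<phi>)"

text \<open>The library's \<^const>\<open>weak_conv_m\<close> covers only measures on the real line.\<close>

definition weak_limit :: "(nat \<Rightarrow> 'a::topological_space measure) \<Rightarrow> 'a measure \<Rightarrow> bool" where
  "weak_limit \<mu> \<nu> \<longleftrightarrow> prob_space \<nu> \<and> sets \<nu> = sets borel \<and>
     (\<forall>f::'a \<Rightarrow> real. continuous_on UNIV f \<and> bounded (range f) \<longrightarrow>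
        (\<lambda>n. \<integral>x. f x \<partial>\<mu> n) \<longlonglongrightarrow> (\<integral>x. f x \<partial>\<nu>))"

definition DG_infinite_volume :: "real \<Rightarrow> config measure \<Rightarrow> bool" where
  "DG_infinite_volume \<beta> \<pi> \<longleftrightarrow> weak_limit (DG_box \<beta>) \<pi>"

definition discrete_harmonic_on :: "site set \<Rightarrow> (site \<Rightarrow> real) \<Rightarrow> bool" where
  "discrete_harmonic_on A u \<longleftrightarrow> (\<forall>x\<in>A. u x = (\<Sum>y | adj x y. u y) / 4)"

text \<open>The boundary values are imposed on the whole inner ball and on the whole exterior of the
  outer ball; the values that matter for harmonicity in the annulus are those at the neighbours
  of the annulus. These conditions determine the function uniquely.\<close>

definition annulus_profile :: "real \<Rightarrow> real \<Rightarrow> real \<Rightarrow> (site \<Rightarrow> real) \<Rightarrow> bool" where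
  "annulus_profile r R h u \<longleftrightarrow>
     discrete_harmonic_on (lball R - lball r) u \<and>
     (\<forall>x \<in> lball r. u x = h) \<and> (\<forall>x. x \<notin> lball R \<longrightarrow> u x = 0)"

definition outer_radius :: "nat \<Rightarrow> int" where
  "outer_radius h = \<lceil>20 * real h / ln (real h)\<rceil>"

end

theory Submission
  imports Defs "HOL-Real_Asymp.Real_Asymp"
begin

text \<open>
  Put \<open>L = h / ln h\<close>, so that the outer radius is of order \<open>L\<close>. The proof is a Peierls argument for the
  excess \<open>\<psi> = \<phi> - u\<close> of the field over a reference function \<open>u\<close>; the upper tail uses the harmonic profile
  as \<open>u\<close>, and the lower tail uses minus the profile for the field \<open>- \<phi>\<close>.

  If \<open>\<psi> > a\<close> on the inner side and \<open>\<psi> \<le> a\<close> on the outer side of the edge boundary of a finite set \<open>S\<close>,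
  then lowering \<open>\<phi>\<close> by one on \<open>S\<close> changes the energy by the sum of \<open>2 (\<phi> x - \<phi> y) - 1\<close> over the boundary edges
  (\<open>energy_lower\<close>). This sum is twice the flux of \<open>u\<close> out of \<open>S\<close> plus the sum of \<open>2 (\<psi> x - \<psi> y) - 1\<close>.
  The flux is under control because \<open>u\<close> is harmonic in the annulus. The second sum is the difficulty: \<open>u\<close> is
  not integer valued, so \<open>\<psi>\<close> may drop by less than \<open>1 / 2\<close> along an edge, and then the edge contributes
  negatively. A single level \<open>a\<close> can therefore fail to gain energy; in fact an integer surface with a
  noninteger slope has steps that move at no cost.

  The remedy is to look at many levels \<open>a = 0, 2, 4, \<dots>\<close> at once. An edge along which \<open>\<psi>\<close> drops by less than
  \<open>2\<close> crosses at most one of these levels, and its inner endpoint no longer belongs to the region of the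
  next level. Hence a level at which such shallow edges are more than one eighth of the boundary removes, by the
  isoperimetric inequality, an amount of volume that lowers the square root of the volume by a constant. Only the volume
  near the ball of radius \<open>R\<close> matters, since outside that ball \<open>u\<close> is constant and drops of \<open>\<psi>\<close> are positive integers.
  So among \<open>2 J\<close> consecutive levels with \<open>J\<close> a suitable multiple of \<open>R\<close>, which is of order \<open>L\<close>, at least half
  are good (\<open>good_levels\<close>), and at a good level the gain is at least a quarter of the boundary length
  (\<open>energy_gain\<close>). Averaging over the levels costs a factor \<open>2\<close>, whereas a union bound would
  cost a factor \<open>J\<close>, which is unbounded in \<open>h\<close>. Summing over the possible regions shows that one more unit of
  excess at \<open>z\<close> costs a factor \<open>exp (C' - \<beta>)\<close>, with an absolute constant \<open>C'\<close>, once the excess is of order \<open>L\<close> (\<open>peel_one_level\<close>). Peeling off about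
  \<open>L\<close> units gives the bound \<open>exp (- (\<beta> - C') L)\<close>, which is stronger than the claim.

  Two further points carry the argument. The field must not be lowered on the pinned ball, so a region may have an outer
  and an inner boundary; each is the boundary of a finite connected set with connected complement
  (\<open>excess_region_shape\<close>), and such boundaries are counted by walks, because they are
  connected as sets of edges (\<open>filled_contour_connected\<close>). And the profile is not superharmonic on the
  boundary of the ball of radius \<open>R\<close>. There the flux loses at most \<open>1 / 4\<close> per edge entering the ball as soon as the
  profile is at most \<open>1 / 4\<close> next to that boundary; the boundary edges of \<open>S\<close> outside the ball pay for this
  (\<open>exit_edges_injection\<close>). The factor \<open>20\<close> in the radius bounds these values by about \<open>1 / 10\<close> for large \<open>h\<close>
  (\<open>boundary_value_eventually_small\<close>). For the finitely many remaining \<open>h\<close> the constants \<open>h\<close> and \<open>0\<close>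
  serve as reference functions.
\<close>

section \<open>Connected sets of sites\<close>

lemma adj_iff:
  "adj x y \<longleftrightarrow> y \<in> {(fst x + 1, snd x), (fst x - 1, snd x), (fst x, snd x + 1), (fst x, snd x - 1)}"
  by (cases x; cases y) (auto simp: adj_def)

lemma adj_sym: "adj x y \<Longrightarrow> adj y x"
  by (auto simp: adj_def abs_minus_commute)

lemma nbrs_eq: "{y. adj x y} = {(fst x + 1, snd x), (fst x - 1, snd x), (fst x, snd x + 1), (fst x, snd x - 1)}"
  by (auto simp: adj_iff)

lemma finite_nbrs: "finite {y. adj x y}"
  by (simp add: nbrs_eq)

lemma card_nbrs: "card {y. adj x y} = 4"
  by (simp add: nbrs_eq)

definition joined :: "site set \<Rightarrow> site \<Rightarrow> site \<Rightarrow> bool" where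
  "joined A = (\<lambda>x y. adj x y \<and> x \<in> A \<and> y \<in> A)\<^sup>*\<^sup>*"

definition component :: "site set \<Rightarrow> site \<Rightarrow> site set" where
  "component A x = {y. joined A x y}"

definition connected_sites :: "site set \<Rightarrow> bool" where
  "connected_sites A \<longleftrightarrow> (\<forall>x\<in>A. \<forall>y\<in>A. joined A x y)"

lemma joined_refl [simp]: "joined A x x"
  by (simp add: joined_def)

lemma joined_trans: "joined A x y \<Longrightarrow> joined A y z \<Longrightarrow> joined A x z"
  unfolding joined_def by (rule rtranclp_trans)

lemma joined_step: "adj x y \<Longrightarrow> x \<in> A \<Longrightarrow> y \<in> A \<Longrightarrow> joined A x y"
  unfolding joined_def by (rule r_into_rtranclp) simp

lemma joined_sym: "joined A x y \<Longrightarrow> joined A y x"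
  unfolding joined_def
proof (induction rule: rtranclp_induct)
  case (step y z)
  then show ?case
    by (auto intro: converse_rtranclp_into_rtranclp adj_sym)
qed simp

lemma joined_mono: "A \<subseteq> B \<Longrightarrow> joined A x y \<Longrightarrow> joined B x y"
  unfolding joined_def by (erule rtranclp_mono[THEN predicate2D, rotated]) auto

lemma joined_mem: "joined A x y \<Longrightarrow> x \<in> A \<Longrightarrow> y \<in> A"
  unfolding joined_def by (induction rule: rtranclp_induct) auto

lemma component_self [simp]: "x \<in> component A x"
  by (simp add: component_def)

lemma component_subset: "x \<in> A \<Longrightarrow> component A x \<subseteq> A"
  by (auto simp: component_def dest: joined_mem)

lemma component_mono: "A \<subseteq> B \<Longrightarrow> component A x \<subseteq> component B x"
  by (auto simp: component_def dest: joined_mono)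

lemma component_closed:
  assumes "y \<in> component A x" "adj y w" "x \<in> A" "w \<in> A"
  shows "w \<in> component A x"
  using assms component_subset[of x A] joined_step[of y w A] joined_trans
  unfolding component_def by blast

lemma component_connected:
  assumes "x \<in> A"
  shows "connected_sites (component A x)"
proof -
  have *: "joined (component A x) x y" if "joined A x y" for y
    using that unfolding joined_def[of A]
  proof (induction rule: rtranclp_induct)
    case (step y w)
    then have y: "y \<in> component A x"
      by (simp add: component_def joined_def)
    then have "w \<in> component A x"
      using step component_closed assms by blast
    then show ?case
      using y step joined_step joined_trans by blast
  qed simp
  then show ?thesis
    unfolding connected_sites_def by (metis component_def joined_sym joined_trans mem_Collect_eq)
qed

lemma connected_subset_component_self:
  assumes "connected_sites Y" "Y \<subseteq> A" "x \<in> Y"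
  shows "Y \<subseteq> component A x"
  using assms joined_mono unfolding connected_sites_def component_def by blast

lemma joined_row:
  assumes "\<And>t. (t, b) \<in> A"
  shows "joined A (s, b) (t, b)"
proof -
  have *: "joined A (s, b) (s + int n, b)" for s n
  proof (induction n)
    case (Suc n)
    have "adj (s + int n, b) (s + int (Suc n), b)"
      by (simp add: adj_def)
    then show ?case
      using Suc joined_trans joined_step assms by blast
  qed simp
  show ?thesis
  proof (cases "s \<le> t")
    case True
    then show ?thesis using *[of s "nat (t - s)"] by simp
  next
    case False
    then show ?thesis using *[of t "nat (s - t)"] joined_sym by simp
  qed
qed

lemma joined_column:
  assumes "\<And>t. (a, t) \<in> A"
  shows "joined A (a, s) (a, t)"
proof -
  have *: "joined A (a, s) (a, s + int n)" for s n
  proof (induction n)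
    case (Suc n)
    have "adj (a, s + int n) (a, s + int (Suc n))"
      by (simp add: adj_def)
    then show ?case
      using Suc joined_trans joined_step assms by blast
  qed simp
  show ?thesis
  proof (cases "s \<le> t")
    case True
    then show ?thesis using *[of s "nat (t - s)"] by simp
  next
    case False
    then show ?thesis using *[of t "nat (s - t)"] joined_sym by simp
  qed
qed

lemma connected_outside_box: "connected_sites (- box M)"
proof -
  let ?A = "- box M" and ?c = "int M + 1"
  have row: "joined ?A (s, b) (t, b)" if "b < - int M \<or> b > int M" for s t b
    using that by (intro joined_row) (auto simp: box_def)
  have col: "joined ?A (a, s) (a, t)" if "a < - int M \<or> a > int M" for s t a
    using that by (intro joined_column) (auto simp: box_def)
  have "joined ?A x (?c, ?c)" if "x \<in> ?A" for x
  proof (cases x)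
    case (Pair a b)
    show ?thesis
    proof (cases "a < - int M \<or> a > int M")
      case True
      then show ?thesis
        using col[of a b ?c] row[of ?c a ?c] joined_trans Pair by auto
    next
      case False
      then have "b < - int M \<or> b > int M"
        using that Pair by (auto simp: box_def)
      then show ?thesis
        using row[of b a ?c] col[of ?c b ?c] joined_trans Pair by auto
    qed
  qed
  then show ?thesis
    unfolding connected_sites_def using joined_sym joined_trans by blast
qed

lemma joined_UNIV: "joined UNIV x y"
  using joined_trans[OF joined_row[of "snd x" UNIV "fst x" "fst y"] joined_column[of "fst y" UNIV "snd x" "snd y"]]
  by simp

text \<open>The other components of the complement of \<open>C\<close> all touch \<open>C\<close>, because the lattice is connected: a path from such a
  component to \<open>C\<close> stays off the component of \<open>z\<close> until it first meets \<open>C\<close>.\<close>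
lemma complement_component_connected:
  assumes "connected_sites C" "c \<in> C" "z \<notin> C"
  shows "connected_sites (- component (- C) z)"
proof -
  let ?K = "component (- C) z"
  have CK: "C \<subseteq> - ?K"
    using component_subset[of z "- C"] assms by auto
  have *: "\<exists>p\<in>C. joined (- ?K) w p" if "joined UNIV w c" "w \<notin> ?K" for w
    using that unfolding joined_def[of UNIV]
  proof (induction rule: converse_rtranclp_induct)
    case base
    then show ?case using assms by (intro bexI[of _ c]) auto
  next
    case (step w w')
    show ?case
    proof (cases "w \<in> C")
      case False
      then have w': "w' \<notin> ?K"
        using step component_closed[of w' "- C" z w] adj_sym assms by blast
      then obtain p where "p \<in> C" "joined (- ?K) w' p"
        using step by auto
      moreover have "joined (- ?K) w w'"
        using step w' by (intro joined_step) auto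
      ultimately show ?thesis using joined_trans by blast
    qed (use joined_refl in blast)
  qed
  have "joined (- ?K) w c" if w: "w \<notin> ?K" for w
  proof -
    obtain p where p: "p \<in> C" "joined (- ?K) w p"
      using *[OF joined_UNIV w] by blast
    moreover have "joined (- ?K) p c"
      using assms p CK joined_mono unfolding connected_sites_def by blast
    ultimately show ?thesis using joined_trans by blast
  qed
  then show ?thesis
    unfolding connected_sites_def using joined_sym joined_trans by blast
qed

section \<open>Edge boundaries\<close>

definition out_edges :: "site set \<Rightarrow> (site \<times> site) set" where
  "out_edges S = {(x, y). adj x y \<and> x \<in> S \<and> y \<notin> S}"

lemma finite_out_edges: "finite S \<Longrightarrow> finite (out_edges S)"
  by (rule finite_subset[of _ "SIGMA x:S. {y. adj x y}"]) (auto simp: out_edges_def finite_nbrs)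

text \<open>Connected sets without holes; their edge boundaries are the contours of the Peierls argument.\<close>
definition filled :: "site set \<Rightarrow> bool" where
  "filled K \<longleftrightarrow> finite K \<and> connected_sites K \<and> connected_sites (- K)"

lemma finite_last_true:
  fixes P :: "nat \<Rightarrow> bool"
  assumes "finite {k. P k}" "P 0"
  shows "\<exists>k. (\<forall>i\<le>k. P i) \<and> \<not> P (Suc k)"
proof (rule ccontr)
  assume "\<not> ?thesis"
  then have *: "\<And>k. (\<forall>i\<le>k. P i) \<Longrightarrow> P (Suc k)" by blast
  have "\<forall>i\<le>k. P i" for k
    by (induction k) (use assms * le_Suc_eq in auto)
  then have "{k. P k} = UNIV" by blast
  then show False using assms by simp
qed

text \<open>The first step of the ray that leaves \<open>S\<close>. In an axis direction it is a boundary edge, which is how boundary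
  edges are produced below.\<close>
lemma ray_exit:
  fixes S :: "site set"
  assumes "finite S" "(a, b) \<in> S" "(d, e) \<noteq> (0, 0)"
  shows "\<exists>k::nat. (\<forall>i\<le>k. (a + int i * d, b + int i * e) \<in> S) \<and>
    (a + int (Suc k) * d, b + int (Suc k) * e) \<notin> S"
proof (rule finite_last_true)
  have "inj (\<lambda>k. (a + int k * d, b + int k * e))"
    using assms(3) by (auto simp: inj_def)
  then have "finite ((\<lambda>k. (a + int k * d, b + int k * e)) -` S)"
    using assms(1) by (simp add: finite_vimageI)
  then show "finite {k. (a + int k * d, b + int k * e) \<in> S}"
    by (simp add: vimage_def)
qed (use assms in simp)

lemma card_out_edges_projections:
  assumes "finite S"
  shows "2 * card (fst ` S) + 2 * card (snd ` S) \<le> card (out_edges S)"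
proof -
  define E where "E d e = {(x, y). (x, y) \<in> out_edges S \<and> y = (fst x + d, snd x + e)}" for d e
  have fin: "finite (E d e)" for d e
    by (rule finite_subset[OF _ finite_out_edges[OF assms]]) (auto simp: E_def)
  have col: "card (fst ` S) \<le> card (E 0 e)" if e: "e = 1 \<or> e = -1" for e
  proof -
    have "fst ` S \<subseteq> (fst \<circ> fst) ` E 0 e"
    proof
      fix a assume "a \<in> fst ` S"
      then obtain b where "(a, b) \<in> S" by force
      then obtain k where k: "\<forall>i\<le>k. (a + int i * 0, b + int i * e) \<in> S" "(a + int (Suc k) * 0, b + int (Suc k) * e) \<notin> S"
        using ray_exit[OF assms, of a b 0 e] e by auto
      have "((a, b + int k * e), (a, b + int (Suc k) * e)) \<in> E 0 e"
        using k(1)[rule_format, of k] k(2) e by (auto simp: E_def out_edges_def adj_def algebra_simps)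
      then show "a \<in> (fst \<circ> fst) ` E 0 e" by force
    qed
    then show ?thesis by (meson card_image_le card_mono fin finite_imageI le_trans)
  qed
  have row: "card (snd ` S) \<le> card (E d 0)" if d: "d = 1 \<or> d = -1" for d
  proof -
    have "snd ` S \<subseteq> (snd \<circ> fst) ` E d 0"
    proof
      fix b assume "b \<in> snd ` S"
      then obtain a where "(a, b) \<in> S" by force
      then obtain k where k: "\<forall>i\<le>k. (a + int i * d, b + int i * 0) \<in> S" "(a + int (Suc k) * d, b + int (Suc k) * 0) \<notin> S"
        using ray_exit[OF assms, of a b d 0] d by auto
      have "((a + int k * d, b), (a + int (Suc k) * d, b)) \<in> E d 0"
        using k(1)[rule_format, of k] k(2) d by (auto simp: E_def out_edges_def adj_def algebra_simps)
      then show "b \<in> (snd \<circ> fst) ` E d 0" by force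
    qed
    then show ?thesis by (meson card_image_le card_mono fin finite_imageI le_trans)
  qed
  have "card (E 0 1 \<union> E 0 (-1) \<union> E 1 0 \<union> E (-1) 0)
    = card (E 0 1 \<union> E 0 (-1) \<union> E 1 0) + card (E (-1) 0)"
    by (rule card_Un_disjoint) (simp_all add: fin, auto simp: E_def)
  also have "card (E 0 1 \<union> E 0 (-1) \<union> E 1 0) = card (E 0 1 \<union> E 0 (-1)) + card (E 1 0)"
    by (rule card_Un_disjoint) (simp_all add: fin, auto simp: E_def)
  also have "card (E 0 1 \<union> E 0 (-1)) = card (E 0 1) + card (E 0 (-1))"
    by (rule card_Un_disjoint) (simp_all add: fin, auto simp: E_def)
  finally have "card (E 0 1) + card (E 0 (-1)) + card (E 1 0) + card (E (-1) 0)
    = card (E 0 1 \<union> E 0 (-1) \<union> E 1 0 \<union> E (-1) 0)" ..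
  also have "\<dots> \<le> card (out_edges S)"
    by (rule card_mono[OF finite_out_edges[OF assms]]) (auto simp: E_def)
  finally show ?thesis
    using col[of 1] col[of "-1"] row[of 1] row[of "-1"] by simp
qed

text \<open>Each occupied row and each occupied column contributes an exit in both directions, and \<open>S\<close> has at most
  as many points as the product of its two projections.\<close>
lemma isoperimetric:
  assumes "finite S"
  shows "4 * sqrt (card S) \<le> card (out_edges S)"
proof -
  let ?p = "real (card (fst ` S))" and ?q = "real (card (snd ` S))"
  have "card S \<le> card (fst ` S \<times> snd ` S)"
    using assms by (intro card_mono) force+
  then have "real (card S) \<le> ?p * ?q"
    by (simp add: card_cartesian_product flip: of_nat_mult)
  also have "\<dots> \<le> ((?p + ?q) / 2)\<^sup>2"
    using sum_squares_ge_zero[of "?p - ?q" 0] by (simp add: power2_eq_square field_simps)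
  finally have "sqrt (card S) \<le> (?p + ?q) / 2"
    by (intro real_le_lsqrt) auto
  moreover have "2 * ?p + 2 * ?q \<le> real (card (out_edges S))"
    using card_out_edges_projections[OF assms] by linarith
  ultimately show ?thesis by simp
qed

section \<open>Counting contours\<close>

text \<open>The relation looks at the inner endpoints only. Two boundary edges of one unit square are always
  related, and every edge has at most 36 related edges.\<close>
definition close_edges :: "site \<times> site \<Rightarrow> site \<times> site \<Rightarrow> bool" where
  "close_edges e f \<longleftrightarrow>
     \<bar>fst (fst e) - fst (fst f)\<bar> \<le> 1 \<and> \<bar>snd (fst e) - snd (fst f)\<bar> \<le> 1 \<and> adj (fst f) (snd f)"

lemma joined_const:
  assumes "joined A x y" "\<And>p q. adj p q \<Longrightarrow> p \<in> A \<Longrightarrow> q \<in> A \<Longrightarrow> f p = f q"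
  shows "f x = f y"
  using assms(1) unfolding joined_def
  by (induction rule: rtranclp_induct) (auto dest!: assms(2))

text \<open>A closed 1-form with coefficients mod 2 is exact. \<open>H\<close> lives on the horizontal and \<open>W\<close> on the vertical edges, and
  the hypothesis says that an even number of edges of every unit square is marked. Finite support lets the potential be
  the parity of the marked horizontal edges to the left.\<close>
lemma lattice_cocycle_exact:
  fixes H W :: "int \<Rightarrow> int \<Rightarrow> bool"
  assumes fin: "finite {p. H (fst p) (snd p)}" "finite {p. W (fst p) (snd p)}"
    and closed: "\<And>a b. (H a b \<noteq> H a (b + 1)) = (W a b \<noteq> W (a + 1) b)"
  shows "\<exists>f :: int \<Rightarrow> int \<Rightarrow> bool. (\<forall>a b. (f a b \<noteq> f (a + 1) b) = H a b) \<and> (\<forall>a b. (f a b \<noteq> f a (b + 1)) = W a b)"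
proof -
  define f where "f a b = odd (card {t. t < a \<and> H t b})" for a b
  have finH: "finite {t. t < a \<and> H t b}" for a b
  proof (rule finite_surj[OF fin(1)])
    show "{t. t < a \<and> H t b} \<subseteq> fst ` {p. H (fst p) (snd p)}"
    proof
      fix t assume "t \<in> {t. t < a \<and> H t b}"
      then have "(t, b) \<in> {p. H (fst p) (snd p)}" by simp
      then have "fst (t, b) \<in> fst ` {p. H (fst p) (snd p)}" by (rule imageI)
      then show "t \<in> fst ` {p. H (fst p) (snd p)}" by simp
    qed
  qed
  have step: "(f a b \<noteq> f (a + 1) b) = H a b" for a b
  proof (cases "H a b")
    case True
    then have "{t. t < a + 1 \<and> H t b} = insert a {t. t < a \<and> H t b}" by auto
    then show ?thesis using True finH by (simp add: f_def)
  next
    case False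
    then have "{t. t < a + 1 \<and> H t b} = {t. t < a \<and> H t b}"
      by (metis zless_add1_eq)
    then show ?thesis using False by (simp add: f_def)
  qed
  \<comment> \<open>To the left of the support the potential and the form both vanish, which starts the induction on the column.\<close>
  define A where "A = fst ` ({p. H (fst p) (snd p)} \<union> {p. W (fst p) (snd p)})"
  have finA: "finite A" using fin by (simp add: A_def)
  obtain m where m: "\<And>t. t \<in> A \<Longrightarrow> m \<le> t"
    using bdd_below_finite[OF finA] unfolding bdd_below_def by blast
  have mH: "\<not> H a b" and mW: "\<not> W a b" if "a < m" for a b
  proof -
    have "a \<notin> A" using m[of a] that by auto
    then have "fst (a, b) \<notin> A" by simp
    then show "\<not> H a b" "\<not> W a b"
      unfolding A_def by (metis (mono_tags, lifting) UnCI fst_conv imageI mem_Collect_eq snd_conv)+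
  qed
  have "(f a b \<noteq> f a (b + 1)) = W a b" for a b
  proof (cases "a < m")
    case True
    then have empty: "{t. t < a \<and> H t b} = {}" "{t. t < a \<and> H t (b + 1)} = {}"
      using mH by auto
    show ?thesis using mW[OF True] unfolding f_def empty by simp
  next
    case False
    then have "m - 1 \<le> a" by simp
    then show ?thesis
    proof (induction a rule: int_ge_induct)
      case base
      have empty: "{t. t < m - 1 \<and> H t b} = {}" "{t. t < m - 1 \<and> H t (b + 1)} = {}"
        using mH by auto
      show ?case using mW[of "m - 1"] unfolding f_def empty by simp
    next
      case (step a)
      then show ?case
        using \<open>(f a b \<noteq> f (a + 1) b) = H a b\<close> \<open>\<And>a b. (f a b \<noteq> f (a + 1) b) = H a b\<close> closed[of a b]
        by metis
    qed
  qed
  with step show ?thesis by (intro exI[of _ f]) simp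
qed

text \<open>Any nonempty part \<open>E\<close> of the boundary that is closed under \<open>close_edges\<close> is the whole boundary. A unit square meets the
  boundary of \<open>K\<close> in an even number of edges, and these lie all in \<open>E\<close> or all outside \<open>E\<close>; so \<open>E\<close> is a
  closed form mod 2 and has a potential. The potential is constant on \<open>K\<close> and on its complement, since no edge of \<open>E\<close>
  lies inside either; it jumps across one boundary edge and therefore across all of them.\<close>
lemma filled_contour_connected:
  assumes K: "filled K" and E: "E \<subseteq> out_edges K" "E \<noteq> {}"
    and closed: "\<And>e f. e \<in> E \<Longrightarrow> f \<in> out_edges K \<Longrightarrow> close_edges e f \<Longrightarrow> f \<in> E"
  shows "E = out_edges K"
proof -
  define U where "U x y \<longleftrightarrow> (x, y) \<in> E \<or> (y, x) \<in> E" for x y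
  have finE: "finite E"
    using K E finite_out_edges finite_subset unfolding filled_def by blast
  have U_out: "(x \<in> K) \<noteq> (y \<in> K)" if "U x y" for x y
    using that E by (auto simp: U_def out_edges_def)
  have U_close: "U x' y'" if "U x y" "adj x' y'" "(x' \<in> K) \<noteq> (y' \<in> K)"
    "\<And>p q. p \<in> {x, y} \<Longrightarrow> q \<in> {x', y'} \<Longrightarrow> \<bar>fst p - fst q\<bar> \<le> 1 \<and> \<bar>snd p - snd q\<bar> \<le> 1" for x y x' y'
  proof -
    from that(1) obtain e where e: "e \<in> E" "e = (x, y) \<or> e = (y, x)"
      unfolding U_def by blast
    have "(x', y') \<in> out_edges K \<or> (y', x') \<in> out_edges K"
      using that(2,3) adj_sym by (auto simp: out_edges_def)
    then obtain f where f: "f \<in> out_edges K" "f = (x', y') \<or> f = (y', x')"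
      by blast
    have "close_edges e f"
      using e(2) f(2) that(2) adj_sym[OF that(2)]
        that(4)[of x x'] that(4)[of x y'] that(4)[of y x'] that(4)[of y y']
      by (elim disjE) (simp_all add: close_edges_def)
    then show ?thesis
      using closed e f U_def by blast
  qed
  have finU: "finite {p. U p (g p)}" for g
  proof (rule finite_subset)
    show "{p. U p (g p)} \<subseteq> fst ` E \<union> snd ` E"
      by (auto simp: U_def intro: rev_image_eqI)
  qed (use finE in simp)
  let ?H = "\<lambda>a b. U (a, b) (a + 1, b)" and ?W = "\<lambda>a b. U (a, b) (a, b + 1)"
  have "(?H a b \<noteq> ?H a (b + 1)) = (?W a b \<noteq> ?W (a + 1) b)" for a b
  proof -
    let ?v1 = "(a, b)" and ?v2 = "(a + 1, b)" and ?v3 = "(a, b + 1)" and ?v4 = "(a + 1, b + 1)"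
    have adjs: "adj ?v1 ?v2" "adj ?v3 ?v4" "adj ?v1 ?v3" "adj ?v2 ?v4"
      by (auto simp: adj_def)
    have all: "U x' y'" if "U x y" "(x' \<in> K) \<noteq> (y' \<in> K)" "adj x' y'"
      "{x, y, x', y'} \<subseteq> {?v1, ?v2, ?v3, ?v4}" for x y x' y'
    proof (rule U_close[OF that(1,3,2)])
      fix p q assume "p \<in> {x, y}" "q \<in> {x', y'}"
      then have "p \<in> {?v1, ?v2, ?v3, ?v4}" "q \<in> {?v1, ?v2, ?v3, ?v4}"
        using that(4) by auto
      then show "\<bar>fst p - fst q\<bar> \<le> 1 \<and> \<bar>snd p - snd q\<bar> \<le> 1"
        by auto
    qed
    show ?thesis
    proof (cases "U ?v1 ?v2 \<or> U ?v3 ?v4 \<or> U ?v1 ?v3 \<or> U ?v2 ?v4")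
      case True
      then obtain x y where xy: "U x y" "{x, y} \<subseteq> {?v1, ?v2, ?v3, ?v4}" by blast
      have "U x' y' = ((x' \<in> K) \<noteq> (y' \<in> K))" if "adj x' y'" "{x', y'} \<subseteq> {?v1, ?v2, ?v3, ?v4}" for x' y'
      proof
        assume "(x' \<in> K) \<noteq> (y' \<in> K)"
        moreover have "{x, y, x', y'} \<subseteq> {?v1, ?v2, ?v3, ?v4}"
          using xy(2) that(2) unfolding insert_subset by (intro conjI) simp_all
        ultimately show "U x' y'"
          by (rule all[OF xy(1) _ that(1)])
      qed (rule U_out)
      then have "?H a b = ((?v1 \<in> K) \<noteq> (?v2 \<in> K))" "?H a (b + 1) = ((?v3 \<in> K) \<noteq> (?v4 \<in> K))"
        "?W a b = ((?v1 \<in> K) \<noteq> (?v3 \<in> K))" "?W (a + 1) b = ((?v2 \<in> K) \<noteq> (?v4 \<in> K))"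
        using adjs by (metis insertCI empty_subsetI insert_subset)+
      then show ?thesis by metis
    qed auto
  qed
  then have closed': "(?H a b \<noteq> ?H a (b + 1)) = (?W a b \<noteq> ?W (a + 1) b)" for a b .
  have finHW: "finite {p. ?H (fst p) (snd p)}" "finite {p. ?W (fst p) (snd p)}"
    using finU[of "\<lambda>p. (fst p + 1, snd p)"] finU[of "\<lambda>p. (fst p, snd p + 1)"] by simp_all
  have "\<exists>f :: int \<Rightarrow> int \<Rightarrow> bool. (\<forall>a b. (f a b \<noteq> f (a + 1) b) = ?H a b) \<and> (\<forall>a b. (f a b \<noteq> f a (b + 1)) = ?W a b)"
    by (rule lattice_cocycle_exact[of ?H ?W, OF finHW closed'])
  then obtain f :: "int \<Rightarrow> int \<Rightarrow> bool" where f: "\<forall>a b. (f a b \<noteq> f (a + 1) b) = ?H a b" "\<forall>a b. (f a b \<noteq> f a (b + 1)) = ?W a b"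
    by (elim exE conjE)
  define F where "F p = f (fst p) (snd p)" for p
  have U_sym: "U x y = U y x" for x y
    unfolding U_def by (rule disj_commute)
  have F: "(F x \<noteq> F y) = U x y" if "adj x y" for x y
  proof -
    have "y \<in> {(fst x + 1, snd x), (fst x - 1, snd x), (fst x, snd x + 1), (fst x, snd x - 1)}"
      using that by (simp add: adj_iff)
    then show ?thesis
      using f(1)[rule_format, of "fst x" "snd x"] f(2)[rule_format, of "fst x" "snd x"]
        f(1)[rule_format, of "fst x - 1" "snd x"] f(2)[rule_format, of "fst x" "snd x - 1"]
        U_sym[of x y]
      by (auto simp: F_def)
  qed
  have const: "F x = F y" if "joined A x y" "A = K \<or> A = - K" for x y A
    by (rule joined_const[OF that(1)]) (use F U_out that(2) in blast)
  obtain x0 y0 where xy0: "(x0, y0) \<in> E"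
    using E by auto
  then have xy0': "adj x0 y0" "x0 \<in> K" "y0 \<notin> K"
    using E by (auto simp: out_edges_def)
  have "U x0 y0" using xy0 by (simp add: U_def)
  then have F0: "F x0 \<noteq> F y0" using F[OF xy0'(1)] by simp
  show ?thesis
  proof (rule equalityI[OF E(1) subsetI])
    fix e assume e: "e \<in> out_edges K"
    obtain x y where xy: "e = (x, y)" "adj x y" "x \<in> K" "y \<notin> K"
      using e by (auto simp: out_edges_def)
    have "F x = F x0" "F y = F y0"
      using K xy xy0' const unfolding filled_def connected_sites_def by blast+
    then have "U x y"
      using F[OF xy(2)] F0 by simp
    moreover have "(y, x) \<notin> E"
      using xy E(1) by (auto simp: out_edges_def)
    ultimately show "e \<in> E"
      using xy by (simp add: U_def)
  qed
qed

text \<open>A connected set of \<open>m\<close> points is covered by a walk with \<open>2 m - 1\<close> vertices: each new point is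
  visited by a detour from a neighbour and back. This reduces counting connected sets to counting walks.\<close>
lemma walk_covering:
  fixes R :: "'a \<Rightarrow> 'a \<Rightarrow> bool"
  assumes fin: "finite E" and x: "x \<in> E"
    and sym: "\<And>a b. a \<in> E \<Longrightarrow> b \<in> E \<Longrightarrow> R a b \<Longrightarrow> R b a"
    and conn: "\<And>F. F \<subseteq> E \<Longrightarrow> F \<noteq> {} \<Longrightarrow> (\<forall>a\<in>F. \<forall>b\<in>E. R a b \<longrightarrow> b \<in> F) \<Longrightarrow> F = E"
    and "1 \<le> m" "m \<le> card E"
  shows "\<exists>w. length w + 1 = 2 * m \<and> hd w = x \<and> successively R w \<and> set w \<subseteq> E \<and> card (set w) = m"
  using assms(5,6)
proof (induction m rule: dec_induct)
  case base
  then show ?case using x by (intro exI[of _ "[x]"]) auto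
next
  case (step m)
  then obtain w where w: "length w + 1 = 2 * m" "hd w = x" "successively R w" "set w \<subseteq> E" "card (set w) = m"
    by auto
  then have ne: "set w \<noteq> {}" "set w \<noteq> E"
    using step by auto
  then obtain a b where ab: "a \<in> set w" "b \<in> E" "R a b" "b \<notin> set w"
    using conn[OF w(4)] by blast
  then obtain us vs where us: "w = us @ a # vs"
    by (meson split_list)
  let ?w = "us @ a # b # a # vs"
  have "R b a" using ab w sym by blast
  then have "successively R ?w"
    using w(3) ab(3) by (auto simp: us successively_append_iff)
  moreover have "set ?w = insert b (set w)" using us by auto
  moreover have "hd ?w = x" using w(2) us by (cases us) auto
  ultimately show ?case
    using w us ab by (intro exI[of _ ?w]) auto
qed

lemma walks_finite_card:
  fixes R :: "'a \<Rightarrow> 'a \<Rightarrow> bool"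
  assumes "\<And>a. finite {b. R a b}" "\<And>a. card {b. R a b} \<le> d"
  shows "finite {w. length w = Suc n \<and> hd w = x \<and> successively R w} \<and>
    card {w. length w = Suc n \<and> hd w = x \<and> successively R w} \<le> d ^ n"
proof (induction n arbitrary: x)
  case 0
  have "{w. length w = Suc 0 \<and> hd w = x \<and> successively R w} = {[x]}"
    by (auto simp: length_Suc_conv)
  then show ?case by simp
next
  case (Suc n)
  let ?A = "\<lambda>n x. {w. length w = Suc n \<and> hd w = x \<and> successively R w}"
  have "w \<in> (\<Union>y\<in>{b. R x b}. (#) x ` ?A n y)" if "w \<in> ?A (Suc n) x" for w
    using that by (cases w rule: remdups_adj.cases) auto
  moreover have "w \<in> ?A (Suc n) x" if "w \<in> (\<Union>y\<in>{b. R x b}. (#) x ` ?A n y)" for w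
  proof -
    from that obtain y v where v: "R x y" "w = x # v" "v \<in> ?A n y"
      by (elim UN_E imageE) auto
    then show ?thesis by (cases v) auto
  qed
  ultimately have "?A (Suc n) x = (\<Union>y\<in>{b. R x b}. (#) x ` ?A n y)"
    by blast
  moreover have "finite (\<Union>y\<in>{b. R x b}. (#) x ` ?A n y)"
    using assms Suc by auto
  moreover have "card (\<Union>y\<in>{b. R x b}. (#) x ` ?A n y) \<le> (\<Sum>y\<in>{b. R x b}. d ^ n)"
  proof (rule order_trans[OF card_UN_le[OF assms(1)] sum_mono])
    fix y
    show "card ((#) x ` ?A n y) \<le> d ^ n"
      using Suc card_image_le order_trans by blast
  qed
  moreover have "(\<Sum>y\<in>{b. R x b}. d ^ n) \<le> d ^ Suc n"
    using assms(2)[of x] by (simp add: mult_right_mono)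
  ultimately show ?case by (metis (no_types, lifting) order_trans)
qed

lemma close_edges_finite_card: "finite {f. close_edges e f} \<and> card {f. close_edges e f} \<le> 36"
proof -
  let ?B = "{fst (fst e) - 1..fst (fst e) + 1} \<times> {snd (fst e) - 1..snd (fst e) + 1}"
  have eq: "{f. close_edges e f} = (SIGMA x:?B. {y. adj x y})"
  proof (intro set_eqI)
    fix f :: "site \<times> site"
    obtain a b y where f: "f = ((a, b), y)" by (metis surj_pair)
    show "f \<in> {f. close_edges e f} \<longleftrightarrow> f \<in> (SIGMA x:?B. {y. adj x y})"
      unfolding close_edges_def f by (simp add: abs_le_iff) linarith
  qed
  have "card ?B = 9" by (simp add: card_cartesian_product)
  then show ?thesis
    unfolding eq by (subst card_SigmaI) (auto simp: finite_nbrs card_nbrs)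
qed

text \<open>A set is recovered from its edge boundary up to complement, and a finite set differs from the complement of a finite
  set.\<close>
lemma out_edges_inj:
  assumes "finite S" "S \<noteq> {}" "out_edges S = out_edges T" "finite T"
  shows "S = T"
proof -
  have "(x \<in> S \<longleftrightarrow> x \<in> T) = (y \<in> S \<longleftrightarrow> y \<in> T)" if "adj x y" for x y
  proof -
    have "(x, y) \<in> out_edges S \<longleftrightarrow> (x, y) \<in> out_edges T" "(y, x) \<in> out_edges S \<longleftrightarrow> (y, x) \<in> out_edges T"
      using assms by auto
    then show ?thesis using that adj_sym[OF that] by (auto simp: out_edges_def)
  qed
  then have "(x \<in> S \<longleftrightarrow> x \<in> T) = (y \<in> S \<longleftrightarrow> y \<in> T)" for x y
    using joined_const[OF joined_UNIV, of "\<lambda>x. x \<in> S \<longleftrightarrow> x \<in> T"] by blast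
  moreover have "\<exists>x. x \<notin> S \<union> T"
    using ex_new_if_finite[of "S \<union> T"] assms infinite_UNIV_char_0
    by (simp add: finite_prod)
  ultimately show ?thesis by blast
qed

text \<open>A region that reaches \<open>k\<close> steps to the right of its base point occupies more than \<open>k\<close> columns, so its boundary has
  more than \<open>k\<close> edges. This leaves only as many choices for a root edge as the boundary has edges.\<close>
lemma contour_meets_ray:
  assumes "finite S" "(a, b) \<in> S"
  shows "\<exists>k<card (out_edges S). ((a + int k, b), (a + int k + 1, b)) \<in> out_edges S"
proof -
  obtain k where k: "\<forall>i\<le>k. (a + int i * 1, b + int i * 0) \<in> S" "(a + int (Suc k) * 1, b + int (Suc k) * 0) \<notin> S"
    using ray_exit[OF assms, of 1 0] by auto
  have "card ((\<lambda>i. a + int i) ` {..k}) \<le> card (fst ` S)"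
    using k(1) assms(1) by (intro card_mono) force+
  then have "Suc k \<le> card (fst ` S)"
    by (subst (asm) card_image) (auto simp: inj_on_def)
  then have "k < card (out_edges S)"
    using card_out_edges_projections[OF assms(1)] by simp
  moreover have "((a + int k, b), (a + int k + 1, b)) \<in> out_edges S"
    using k(1)[rule_format, of k] k(2) by (auto simp: out_edges_def adj_def algebra_simps)
  ultimately show ?thesis by blast
qed

lemma card_contours:
  assumes "0 < n"
  shows "card {S. S \<subseteq> box M \<and> filled S \<and> z \<in> S \<and> card (out_edges S) = n} \<le> n * 36 ^ (2 * n)"
proof -
  let ?R = "close_edges"
  define A where "A k = {w. length w = Suc (2 * n - 2) \<and>
    hd w = ((fst z + int k, snd z), (fst z + int k + 1, snd z)) \<and> successively ?R w}" for k
  let ?\<S> = "{S. S \<subseteq> box M \<and> filled S \<and> z \<in> S \<and> card (out_edges S) = n}"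
  have A: "finite (A k)" "card (A k) \<le> 36 ^ (2 * n - 2)" for k
    unfolding A_def using walks_finite_card[of ?R 36] close_edges_finite_card by auto
  have sub: "out_edges ` ?\<S> \<subseteq> set ` (\<Union>k<n. A k)"
  proof
    fix E assume "E \<in> out_edges ` ?\<S>"
    then obtain S where S: "filled S" "z \<in> S" "card (out_edges S) = n" "E = out_edges S" by auto
    then have finS: "finite S" by (simp add: filled_def)
    obtain k where k: "k < n" "((fst z + int k, snd z), (fst z + int k + 1, snd z)) \<in> E"
      using contour_meets_ray[OF finS, of "fst z" "snd z"] S by auto
    have "\<exists>w. length w + 1 = 2 * n \<and> hd w = ((fst z + int k, snd z), (fst z + int k + 1, snd z))
      \<and> successively ?R w \<and> set w \<subseteq> E \<and> card (set w) = n"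
    proof (rule walk_covering[OF _ k(2)])
      show "finite E" using S finS finite_out_edges by simp
      show "?R b a" if "a \<in> E" "b \<in> E" "?R a b" for a b
        using that S(4) by (auto simp: close_edges_def out_edges_def abs_minus_commute)
      show "F = E" if "F \<subseteq> E" "F \<noteq> {}" "\<forall>a\<in>F. \<forall>b\<in>E. ?R a b \<longrightarrow> b \<in> F" for F
        using filled_contour_connected[OF S(1)] that S(4) by blast
    qed (use assms S in auto)
    then obtain w where w: "length w + 1 = 2 * n" "hd w = ((fst z + int k, snd z), (fst z + int k + 1, snd z))"
      "successively ?R w" "set w \<subseteq> E" "card (set w) = n" by blast
    have "set w = E"
      using w S finS finite_out_edges by (intro card_subset_eq) auto
    moreover have "length w = Suc (2 * n - 2)"
      using w(1) assms by linarith
    then have "w \<in> A k" using w by (auto simp: A_def)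
    ultimately show "E \<in> set ` (\<Union>k<n. A k)" using k by blast
  qed
  have "inj_on out_edges ?\<S>"
  proof (rule inj_onI)
    fix S T assume "S \<in> ?\<S>" "T \<in> ?\<S>" "out_edges S = out_edges T"
    then show "S = T"
      by (intro out_edges_inj) (auto simp: filled_def)
  qed
  then have "card ?\<S> = card (out_edges ` ?\<S>)"
    by (simp add: card_image)
  also have "\<dots> \<le> card (set ` (\<Union>k<n. A k))"
    using sub A by (intro card_mono) auto
  also have "\<dots> \<le> card (\<Union>k<n. A k)"
    using A by (intro card_image_le) auto
  also have "\<dots> \<le> (\<Sum>k<n. card (A k))"
    by (rule card_UN_le) simp
  also have "\<dots> \<le> (\<Sum>k<n. 36 ^ (2 * n - 2))"
    using A by (intro sum_mono) auto
  also have "\<dots> = n * 36 ^ (2 * n - 2)" by simp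
  also have "\<dots> \<le> n * 36 ^ (2 * n)"
    by (intro mult_left_mono power_increasing) auto
  finally show ?thesis .
qed

lemma finite_box: "finite (box M)"
  by (simp add: box_def)

lemma card_out_edges_ge_4:
  assumes "finite S" "z \<in> S"
  shows "4 \<le> card (out_edges S)"
proof -
  have "1 \<le> card (fst ` S)" "1 \<le> card (snd ` S)"
    using assms by (simp_all add: Suc_le_eq card_gt_0_iff, blast+)
  then show ?thesis using card_out_edges_projections[OF assms(1)] by linarith
qed

text \<open>The constant is \<open>2592 = 2 * 36\<^sup>2\<close>: a factor \<open>36\<^sup>2\<close> per edge from the walks, and a factor \<open>2\<close> per edge that absorbs
  the number \<open>n \<le> 2 ^ n\<close> of roots. The power \<open>4\<close> is the shortest possible contour length.\<close>
lemma contour_sum: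
  fixes q :: real
  assumes q: "0 \<le> q" "2592 * q \<le> 1 / 2"
  shows "(\<Sum>S | S \<subseteq> box M \<and> filled S \<and> z \<in> S. q ^ card (out_edges S)) \<le> 2 * (2592 * q) ^ 4"
proof -
  let ?\<S> = "{S. S \<subseteq> box M \<and> filled S \<and> z \<in> S}"
  let ?c = "\<lambda>S. card (out_edges S)"
  let ?x = "2592 * q"
  have fin: "finite ?\<S>"
    by (rule finite_subset[of _ "Pow (box M)"]) (auto simp: finite_box)
  obtain N where N: "\<And>S. S \<in> ?\<S> \<Longrightarrow> ?c S < 4 + N"
    using finite_nat_set_iff_bounded[of "?c ` ?\<S>"] fin
    by (metis (no_types, lifting) finite_imageI image_eqI trans_less_add2)
  have "(\<Sum>S\<in>?\<S>. q ^ ?c S) = (\<Sum>n\<in>{4..<4 + N}. \<Sum>S | S \<in> ?\<S> \<and> ?c S = n. q ^ ?c S)"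
  proof (rule sum.group[symmetric])
    show "?c ` ?\<S> \<subseteq> {4..<4 + N}"
    proof
      fix n assume "n \<in> ?c ` ?\<S>"
      then obtain S where "S \<in> ?\<S>" "n = ?c S" by blast
      then show "n \<in> {4..<4 + N}"
        using N[of S] card_out_edges_ge_4[of S z] by (simp add: filled_def)
    qed
  qed (auto simp: fin)
  also have "\<dots> \<le> (\<Sum>n\<in>{4..<4 + N}. ?x ^ n)"
  proof (rule sum_mono)
    fix n assume n: "n \<in> {4..<4 + N}"
    have "(\<Sum>S | S \<in> ?\<S> \<and> ?c S = n. q ^ ?c S) = card {S. S \<in> ?\<S> \<and> ?c S = n} * q ^ n"
      by simp
    also have "\<dots> \<le> real (n * 36 ^ (2 * n)) * q ^ n"
      using card_contours[of n M z] n q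
      by (intro mult_right_mono iffD2[OF of_nat_le_iff]) (simp_all add: conj_assoc)
    also have "\<dots> = real n * (1296 * q) ^ n"
      by (simp add: power_mult power_mult_distrib)
    also have "\<dots> \<le> 2 ^ n * (1296 * q) ^ n"
    proof (rule mult_right_mono)
      show "real n \<le> 2 ^ n"
        using less_exp[of n] by (metis less_imp_le of_nat_le_iff of_nat_numeral of_nat_power)
    qed (use q in auto)
    also have "\<dots> = ?x ^ n"
      unfolding power_mult_distrib[of 2 "1296 * q" n, symmetric] by (simp add: mult.assoc[symmetric])
    finally show "(\<Sum>S | S \<in> ?\<S> \<and> ?c S = n. q ^ ?c S) \<le> ?x ^ n" .
  qed
  also have "\<dots> = (\<Sum>i<N. ?x ^ 4 * ?x ^ i)"
    using sum.shift_bounds_nat_ivl[of "\<lambda>n. ?x ^ n" 0 4 N]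
    by (simp add: atLeast0LessThan add.commute power_add mult.commute del: power_mult_distrib)
  also have "\<dots> = ?x ^ 4 * (\<Sum>i<N. ?x ^ i)"
    by (simp add: sum_distrib_left)
  also have "\<dots> \<le> ?x ^ 4 * 2"
  proof (rule mult_left_mono)
    have "(\<Sum>i<N. ?x ^ i) \<le> (\<Sum>i<N. (1 / 2) ^ i)"
      using q by (intro sum_mono power_mono) auto
    also have "\<dots> = 2 - 2 * (1 / 2) ^ N"
      by (subst geometric_sum) (simp_all add: field_simps)
    also have "\<dots> \<le> 2"
      by (simp add: geometric_sum)
    finally show "(\<Sum>i<N. ?x ^ i) \<le> 2" .
  qed (use q in auto)
  finally show ?thesis by (simp add: mult.commute)
qed

section \<open>The excess region\<close>


text \<open>Here \<open>D\<close> is the set where the excess is at most the level and \<open>f\<close> is a site outside the box. The two obstacles, the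
  part of \<open>D\<close> joined to the outside of the box and the part joined to the origin (it contains the pinned ball),
  are removed separately and the two resulting components are intersected. Taking the
  components one obstacle at a time gives each factor a connected complement.\<close>
definition excess_region :: "site set \<Rightarrow> site \<Rightarrow> site \<Rightarrow> site set" where
  "excess_region D f z = component (- component D f) z \<inter> component (- component D (0, 0)) z"

definition contours :: "nat \<Rightarrow> site \<Rightarrow> site set set" where
  "contours M z = {S. S \<subseteq> box M \<and> filled S \<and> z \<in> S}"

text \<open>The regions that surround the pinned ball: a contour around \<open>z\<close> with a hole around the origin.\<close>
definition ring_regions :: "nat \<Rightarrow> site \<Rightarrow> site set set" where
  "ring_regions M z = {S. \<exists>K\<in>contours M z. \<exists>H\<in>contours M (0, 0). S = K - H \<and>
     card (out_edges S) = card (out_edges K) + card (out_edges H)}"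

lemma finite_contours: "finite (contours M z)"
  by (rule finite_subset[of _ "Pow (box M)"]) (auto simp: finite_box contours_def)

lemma finite_ring_regions: "finite (ring_regions M z)"
  by (rule finite_subset[of _ "(\<lambda>(K, H). K - H) ` (contours M z \<times> contours M (0, 0))"])
    (auto simp: finite_contours ring_regions_def)

context
  fixes D :: "site set" and f z :: site and M :: nat
  assumes f: "f \<notin> box M" and outside: "- box M \<subseteq> D" and zero: "(0, 0) \<in> D" and z: "z \<notin> D"
begin

lemma outer_component: "f \<in> D" "- box M \<subseteq> component D f" "connected_sites (component D f)" "component D f \<subseteq> D"
proof -
  show fD: "f \<in> D" using f outside by auto
  show "- box M \<subseteq> component D f"
    using f by (intro connected_subset_component_self connected_outside_box outside) auto
  show "connected_sites (component D f)" "component D f \<subseteq> D"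
    using fD by (auto intro: component_connected component_subset[THEN subsetD])
qed

lemma inner_component: "connected_sites (component D (0, 0))" "component D (0, 0) \<subseteq> D"
  using zero by (auto intro: component_connected component_subset[THEN subsetD])

lemma z_not_in: "z \<notin> component D f" "z \<notin> component D (0, 0)"
  using outer_component inner_component z by auto

lemma excess_region_subset: "excess_region D f z \<subseteq> box M - component D (0, 0)"
  using component_subset[of z "- component D f"] component_subset[of z "- component D (0, 0)"]
    outer_component z_not_in unfolding excess_region_def by blast

text \<open>A boundary edge of a component of the complement of an obstacle ends in the obstacle, and its other endpoint would
  belong to the obstacle if it belonged to \<open>D\<close>. So such an edge crosses the level.\<close>
lemma component_complement_boundary:
  assumes "(x, y) \<in> out_edges (component (- component D p) z)" "p \<in> D" "z \<notin> component D p"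
  shows "x \<notin> D" "y \<in> component D p"
proof -
  let ?C = "component D p"
  have xy: "adj x y" "x \<in> component (- ?C) z" "y \<notin> component (- ?C) z"
    using assms by (auto simp: out_edges_def)
  then have x: "x \<notin> ?C"
    using component_subset[of z "- ?C"] assms(3) by auto
  show y: "y \<in> ?C"
    using xy component_closed[of x "- ?C" z y] assms(3) by auto
  show "x \<notin> D"
    using x component_closed[OF y adj_sym[OF xy(1)] assms(2)] by auto
qed

lemma excess_region_boundary:
  assumes "(x, y) \<in> out_edges (excess_region D f z)"
  shows "x \<notin> D" "y \<in> D"
proof -
  have "(x, y) \<in> out_edges (component (- component D f) z) \<or>
      (x, y) \<in> out_edges (component (- component D (0, 0)) z)"
    using assms by (auto simp: out_edges_def excess_region_def)
  then show "x \<notin> D" "y \<in> D"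
    using component_complement_boundary[of x y f] component_complement_boundary[of x y "(0, 0)"]
      outer_component inner_component zero z_not_in by blast+
qed

text \<open>Let \<open>K1\<close> and \<open>K2\<close> be the two intersected components. If the obstacle at the origin encloses \<open>z\<close> by itself,
  or is not surrounded by \<open>K1\<close>, the smaller of \<open>K1\<close> and \<open>K2\<close> is contained in the other. Otherwise the complement of \<open>K2\<close> is
  a hole inside \<open>K1\<close>; no site of the complement of \<open>D\<close> adjacent to one obstacle is cut off by the other, so
  both boundaries appear in full.\<close>
lemma excess_region_shape: "excess_region D f z \<in> contours M z \<union> ring_regions M z"
proof -
  define O1 where "O1 = component D f"
  define O2 where "O2 = component D (0, 0)"
  define K1 where "K1 = component (- O1) z"
  define K2 where "K2 = component (- O2) z"
  have S: "excess_region D f z = K1 \<inter> K2"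
    by (simp add: excess_region_def K1_def K2_def O1_def O2_def)
  have O1: "connected_sites O1" "f \<in> O1" "z \<notin> O1" "- box M \<subseteq> O1"
    and O2: "connected_sites O2" "(0, 0) \<in> O2" "z \<notin> O2"
    using outer_component inner_component z_not_in by (auto simp: O1_def O2_def)
  have K1: "connected_sites K1" "connected_sites (- K1)" "K1 \<subseteq> - O1" "z \<in> K1"
    unfolding K1_def using O1 component_subset[of z "- O1"]
    by (auto intro!: component_connected complement_component_connected[OF O1(1,2)])
  have K2: "connected_sites K2" "connected_sites (- K2)" "K2 \<subseteq> - O2" "z \<in> K2"
    unfolding K2_def using O2 component_subset[of z "- O2"]
    by (auto intro!: component_connected complement_component_connected[OF O2(1,2)])
  have K1_box: "K1 \<subseteq> box M" using K1 O1 by auto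
  then have K1_contour: "K1 \<in> contours M z"
    using K1 finite_subset[OF _ finite_box] by (auto simp: contours_def filled_def)
  have disj: "O1 = O2 \<or> O1 \<inter> O2 = {}"
    unfolding O1_def O2_def component_def using joined_sym joined_trans by blast
  consider (inside) "K1 \<subseteq> K2" | (encl) "K2 \<inter> O1 = {}" | (ring) "\<not> K1 \<subseteq> K2" "K2 \<inter> O1 \<noteq> {}" "O1 \<inter> O2 = {}"
    using disj K1_def K2_def by blast
  then show ?thesis
  proof cases
    case inside
    then show ?thesis using S K1_contour by (simp add: Int_absorb2)
  next
    case encl
    then have "K2 \<subseteq> K1"
      unfolding K1_def using K2 by (intro connected_subset_component_self) auto
    moreover from this have "K2 \<in> contours M z"
      using K1_box K2 finite_subset[OF _ finite_box[of M], of K2] by (auto simp: contours_def filled_def)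
    ultimately show ?thesis using S by (simp add: Int_absorb1)
  next
    case ring
    obtain p where p: "p \<in> K2" "p \<in> O1" using ring by blast
    have "O1 \<subseteq> component (- O2) p"
      using O1 p ring(3) by (intro connected_subset_component_self) auto
    also have "\<dots> \<subseteq> K2"
      using p unfolding K2_def component_def using joined_trans by blast
    finally have O1K2: "O1 \<subseteq> K2" .
    \<comment> \<open>Otherwise \<open>K1\<close> would avoid the inner obstacle and be part of \<open>K2\<close>.\<close>
    have "O2 \<inter> K1 \<noteq> {}"
    proof
      assume "O2 \<inter> K1 = {}"
      then have "K1 \<subseteq> K2"
        unfolding K2_def using K1 by (intro connected_subset_component_self) auto
      with ring show False by blast
    qed
    then obtain s where s: "s \<in> O2" "s \<in> K1" by blast
    have "- K2 \<subseteq> component (- O1) s"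
      using K2 s O1K2 by (intro connected_subset_component_self) auto
    also have "\<dots> \<subseteq> K1"
      using s unfolding K1_def component_def using joined_trans by blast
    finally have HK1: "- K2 \<subseteq> K1" .
    have H: "- K2 \<in> contours M (0, 0)"
      using HK1 K1_box K2 O2 finite_subset[OF _ finite_box[of M], of "- K2"]
      by (auto simp: contours_def filled_def)
    \<comment> \<open>The hole of the ring is the complement of \<open>K2\<close>.\<close>
    have eq: "K1 \<inter> K2 = K1 - (- K2)" by blast
    have "out_edges (K1 \<inter> K2) = out_edges K1 \<union> prod.swap ` out_edges (- K2)"
    proof (intro equalityI subsetI)
      fix e assume "e \<in> out_edges (K1 \<inter> K2)"
      then obtain x y where "e = (x, y)" "adj x y" "x \<in> K1" "x \<in> K2" "y \<notin> K1 \<or> y \<notin> K2"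
        by (auto simp: out_edges_def)
      then show "e \<in> out_edges K1 \<union> prod.swap ` out_edges (- K2)"
        using adj_sym[of x y] by (cases x; cases y) (auto simp: out_edges_def image_iff)
    next
      fix e assume "e \<in> out_edges K1 \<union> prod.swap ` out_edges (- K2)"
      then consider x y where "e = (x, y)" "adj x y" "x \<in> K1" "y \<notin> K1"
        | x y where "e = (x, y)" "adj x y" "x \<in> K2" "y \<notin> K2"
        by (auto simp: out_edges_def adj_sym)
      then show "e \<in> out_edges (K1 \<inter> K2)"
      proof cases
        case (1 x y)
        then have "(x, y) \<in> out_edges K1" by (simp add: out_edges_def)
        then have "x \<notin> D" "y \<in> O1"
          using component_complement_boundary[of x y f] outer_component z_not_in
          by (auto simp: K1_def O1_def)
        then have "x \<notin> O2" "y \<in> K2"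
          using inner_component O1K2 by (auto simp: O2_def)
        then have "x \<in> K2"
          unfolding K2_def using component_closed[of y "- O2" z x] adj_sym[OF 1(2)] O2 by auto
        then show ?thesis using 1 by (simp add: out_edges_def)
      next
        case (2 x y)
        then have yK1: "y \<in> K1" using HK1 by blast
        have "(x, y) \<in> out_edges K2" using 2 by (simp add: out_edges_def)
        then have "x \<notin> D"
          using component_complement_boundary[of x y "(0, 0)"] zero z_not_in
          by (auto simp: K2_def O2_def)
        then have "x \<in> - O1" using outer_component by (auto simp: O1_def)
        then have "x \<in> K1"
          using component_closed[of y "- O1" z x] yK1 adj_sym[OF 2(2)] O1 by (auto simp: K1_def)
        then show ?thesis using 2 by (simp add: out_edges_def)
      qed
    qed
    moreover have "out_edges K1 \<inter> prod.swap ` out_edges (- K2) = {}"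
      using HK1 by (auto simp: out_edges_def)
    moreover have "card (prod.swap ` out_edges (- K2)) = card (out_edges (- K2))"
      by (rule card_image) simp
    moreover have "finite (out_edges K1)" "finite (prod.swap ` out_edges (- K2))"
      using H K1_contour by (auto simp: contours_def filled_def intro!: finite_out_edges)
    ultimately have "card (out_edges (K1 \<inter> K2)) = card (out_edges K1) + card (out_edges (- K2))"
      by (simp add: card_Un_disjoint)
    then have "K1 \<inter> K2 \<in> ring_regions M z"
      unfolding ring_regions_def using K1_contour H eq by blast
    then show ?thesis using S by simp
  qed
qed

end

lemma excess_region_antimono:
  assumes "D \<subseteq> D'"
  shows "excess_region D' f z \<subseteq> excess_region D f z"
proof -
  have "component (- component D' p) z \<subseteq> component (- component D p) z" for p
    using component_mono[OF assms] by (intro component_mono) auto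
  then show ?thesis unfolding excess_region_def by blast
qed

text \<open>A ring is determined by its outer contour and its hole, and its boundary length is the sum of theirs; the sum
  over holes is at most \<open>1\<close>, so rings contribute no more than contours.\<close>
lemma region_sum:
  fixes q :: real
  assumes q: "0 \<le> q" "2592 * q \<le> 1 / 2"
  shows "(\<Sum>S\<in>contours M z \<union> ring_regions M z. q ^ card (out_edges S)) \<le> 4 * (2592 * q) ^ 4"
proof -
  let ?c = "\<lambda>S. card (out_edges S)"
  let ?\<sigma> = "\<lambda>p. \<Sum>S\<in>contours M p. q ^ ?c S"
  have \<sigma>: "0 \<le> ?\<sigma> p" "?\<sigma> p \<le> 2 * (2592 * q) ^ 4" for p
    using contour_sum[OF q, of M p] q by (auto simp: contours_def intro!: sum_nonneg)
  have "2 * (2592 * q) ^ 4 \<le> 2 * (1 / 2) ^ 4"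
    using q by (intro mult_left_mono power_mono) auto
  then have \<sigma>1: "?\<sigma> p \<le> 1" for p
    using \<sigma>(2)[of p] by (simp add: power_divide)
  have "\<forall>S\<in>ring_regions M z. \<exists>P. P \<in> contours M z \<times> contours M (0, 0) \<and> S = fst P - snd P \<and>
     ?c S = ?c (fst P) + ?c (snd P)"
    unfolding ring_regions_def by force
  then obtain g where g: "\<And>S. S \<in> ring_regions M z \<Longrightarrow> g S \<in> contours M z \<times> contours M (0, 0) \<and>
      S = fst (g S) - snd (g S) \<and> ?c S = ?c (fst (g S)) + ?c (snd (g S))"
    by metis
  have inj: "inj_on g (ring_regions M z)"
    by (rule inj_onI) (metis g)
  have "(\<Sum>S\<in>ring_regions M z. q ^ ?c S) = (\<Sum>S\<in>ring_regions M z. q ^ ?c (fst (g S)) * q ^ ?c (snd (g S)))"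
    using g by (intro sum.cong) (auto simp: power_add)
  also have "\<dots> = (\<Sum>P\<in>g ` ring_regions M z. q ^ ?c (fst P) * q ^ ?c (snd P))"
    by (simp add: sum.reindex[OF inj])
  also have "\<dots> \<le> (\<Sum>P\<in>contours M z \<times> contours M (0, 0). q ^ ?c (fst P) * q ^ ?c (snd P))"
    using g q by (intro sum_mono2 image_subsetI) (simp_all add: finite_contours)
  also have "\<dots> = ?\<sigma> z * ?\<sigma> (0, 0)"
    by (simp add: sum_product sum.cartesian_product case_prod_beta)
  also have "\<dots> \<le> ?\<sigma> z * 1"
    using \<sigma> \<sigma>1 by (intro mult_left_mono) auto
  finally have ring: "(\<Sum>S\<in>ring_regions M z. q ^ ?c S) \<le> ?\<sigma> z" by simp
  have "(\<Sum>S\<in>contours M z \<union> ring_regions M z. q ^ ?c S) \<le> ?\<sigma> z + (\<Sum>S\<in>ring_regions M z. q ^ ?c S)"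
    using q by (subst sum_Un) (auto simp: finite_contours finite_ring_regions intro!: sum_nonneg)
  then show ?thesis using ring \<sigma>(2)[of z] by linarith
qed

section \<open>Good levels\<close>

lemma few_bad_levels:
  fixes V :: "nat \<Rightarrow> nat"
  assumes step: "\<And>j. bad j \<Longrightarrow> sqrt (V (Suc j)) \<le> sqrt (V j) - 1 / 16"
    and mono: "\<And>j. V (Suc j) \<le> V j"
  shows "sqrt (V n) + card {j. j < n \<and> bad j} / 16 \<le> sqrt (V 0)"
proof (induction n)
  case (Suc n)
  show ?case
  proof (cases "bad n")
    case True
    then have "{j. j < Suc n \<and> bad j} = insert n {j. j < n \<and> bad j}"
      by (auto simp: less_Suc_eq)
    then show ?thesis using Suc step[OF True] by (simp add: add_divide_distrib)
  next
    case False
    then have "{j. j < Suc n \<and> bad j} = {j. j < n \<and> bad j}"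
      by (auto simp: less_Suc_eq)
    then have "sqrt (V (Suc n)) + card {j. j < Suc n \<and> bad j} / 16
        \<le> sqrt (V n) + card {j. j < n \<and> bad j} / 16"
      using mono[of n] by simp
    then show ?thesis using Suc by (rule order_trans)
  qed
qed simp


text \<open>On the remaining boundary edges the integrand \<open>2 (\<psi> x - \<psi> y) - 1\<close> is at least \<open>3\<close> if the edge touches
  \<open>D\<close>, while for edges off \<open>D\<close>, where the reference function is locally constant, the drop of \<open>\<psi>\<close> is an integer.\<close>
definition shallow_edges :: "(site \<Rightarrow> real) \<Rightarrow> site set \<Rightarrow> site set \<Rightarrow> (site \<times> site) set" where
  "shallow_edges \<psi> D S = {(x, y) \<in> out_edges S. (x \<in> D \<or> y \<in> D) \<and> \<psi> x - \<psi> y < 2}"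

text \<open>The regions decrease with the level. A shallow edge of level \<open>j\<close> has \<open>\<psi> x < 2 j + 2\<close> at its inner endpoint
  while its outer endpoint stays outside the later regions; so \<open>x\<close> is lost at level \<open>j + 1\<close>. With four edges per site this
  bounds the number of shallow edges by four times the volume lost inside the box. At a bad level the loss exceeds
  \<open>1 / 32\<close> of the boundary length, hence \<open>1 / 8\<close> of the square root \<open>v\<close> of the volume, and \<open>v\<close> drops by at least
  \<open>1 / 16\<close>. As \<open>v\<close> starts at most at the side length \<open>2 N + 1\<close> of the box, at most \<open>16 (2 N + 1)\<close> levels are
  bad.\<close>
lemma good_levels:
  fixes \<psi> :: "site \<Rightarrow> real" and S :: "nat \<Rightarrow> site set"
  assumes fin: "\<And>j. finite (S j)" and dec: "\<And>j. S (Suc j) \<subseteq> S j"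
    and level: "\<And>j x y. (x, y) \<in> out_edges (S j) \<Longrightarrow> 2 * real j < \<psi> x \<and> \<psi> y \<le> 2 * real j"
    and D: "\<And>x y. adj x y \<Longrightarrow> x \<in> D \<or> y \<in> D \<Longrightarrow> x \<in> box N"
    and J: "J = 16 * (2 * N + 1)"
  shows "J \<le> card {j. j < 2 * J \<and> 8 * card (shallow_edges \<psi> D (S j)) \<le> card (out_edges (S j))}"
proof -
  define V where "V j = card (S j \<inter> box N)" for j
  define bad where "bad j \<longleftrightarrow> card (out_edges (S j)) < 8 * card (shallow_edges \<psi> D (S j))" for j
  have mono: "V (Suc j) \<le> V j" for j
    unfolding V_def using dec finite_box by (intro card_mono) auto
  have shallow: "card (shallow_edges \<psi> D (S j)) \<le> 4 * (V j - V (Suc j))" for j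
  proof -
    let ?X = "(S j \<inter> box N) - (S (Suc j) \<inter> box N)"
    have "shallow_edges \<psi> D (S j) \<subseteq> (SIGMA x:?X. {y. adj x y})"
    proof
      fix e assume "e \<in> shallow_edges \<psi> D (S j)"
      then obtain x y where e: "e = (x, y)" "(x, y) \<in> out_edges (S j)" "x \<in> D \<or> y \<in> D" "\<psi> x - \<psi> y < 2"
        by (auto simp: shallow_edges_def)
      then have xy: "adj x y" "x \<in> S j" "y \<notin> S j" by (auto simp: out_edges_def)
      have "x \<notin> S (Suc j)"
      proof
        assume "x \<in> S (Suc j)"
        then have "(x, y) \<in> out_edges (S (Suc j))"
          using xy dec by (auto simp: out_edges_def)
        then show False using level[of x y "Suc j"] level[OF e(2)] e(4) by simp
      qed
      then show "e \<in> (SIGMA x:?X. {y. adj x y})"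
        using e xy D by auto
    qed
    then have "card (shallow_edges \<psi> D (S j)) \<le> card (SIGMA x:?X. {y. adj x y})"
      by (intro card_mono) (auto simp: finite_box finite_nbrs)
    also have "\<dots> = 4 * card ?X"
      using finite_box[of N] by (subst card_SigmaI) (auto simp: finite_nbrs card_nbrs)
    also have "card ?X = V j - V (Suc j)"
      unfolding V_def using finite_box[of N] dec[of j] by (intro card_Diff_subset) auto
    finally show ?thesis .
  qed
  have step: "sqrt (V (Suc j)) \<le> sqrt (V j) - 1 / 16" if "bad j" for j
  proof -
    define v where "v = sqrt (V j)"
    have "V j \<le> card (S j)"
      unfolding V_def using fin by (intro card_mono) auto
    then have "4 * v \<le> 4 * sqrt (card (S j))" by (simp add: v_def)
    also have "\<dots> \<le> card (out_edges (S j))" by (rule isoperimetric[OF fin])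
    also have "\<dots> < real (8 * card (shallow_edges \<psi> D (S j)))"
      using that unfolding bad_def by linarith
    also have "\<dots> \<le> real (32 * (V j - V (Suc j)))"
      using shallow[of j] by linarith
    also have "\<dots> = 32 * (real (V j) - real (V (Suc j)))"
      using mono[of j] by (simp add: of_nat_diff)
    finally have 1: "4 * v < 32 * (real (V j) - real (V (Suc j)))" .
    have "V j \<noteq> 0"
    proof
      assume "V j = 0"
      with 1 show False by (simp add: v_def)
    qed
    then have "1 \<le> v" by (simp add: v_def)
    have "real (V (Suc j)) \<le> real (V j) - v / 8" using 1 by (simp add: field_simps)
    also have "\<dots> = v\<^sup>2 - v / 8" by (simp add: v_def)
    also have "\<dots> \<le> (v - 1 / 16)\<^sup>2" by (simp add: power2_eq_square algebra_simps)
    finally have "sqrt (V (Suc j)) \<le> v - 1 / 16"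
      using \<open>1 \<le> v\<close> by (intro real_le_lsqrt) auto
    then show ?thesis by (simp add: v_def)
  qed
  have "V 0 \<le> card (box N)"
    unfolding V_def by (intro card_mono) (auto simp: finite_box)
  also have "\<dots> = (2 * N + 1)\<^sup>2"
    by (simp add: box_def card_cartesian_product power2_eq_square nat_add_distrib nat_mult_distrib)
  finally have "real (V 0) \<le> real ((2 * N + 1)\<^sup>2)"
    by (rule iffD2[OF of_nat_le_iff])
  then have "sqrt (V 0) \<le> 2 * real N + 1"
    by (intro real_le_lsqrt) (simp_all add: add.commute)
  moreover have "sqrt (V (2 * J)) + card {j. j < 2 * J \<and> bad j} / 16 \<le> sqrt (V 0)"
    by (rule few_bad_levels[of bad V, OF step mono])
  moreover have "0 \<le> sqrt (V (2 * J))" by simp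
  ultimately have "card {j. j < 2 * J \<and> bad j} / 16 \<le> 2 * real N + 1" by linarith
  then have "real (card {j. j < 2 * J \<and> bad j}) \<le> real J"
    by (simp add: J)
  then have bad: "card {j. j < 2 * J \<and> bad j} \<le> J" by simp
  have "2 * J = card ({j. j < 2 * J \<and> bad j} \<union> {j. j < 2 * J \<and> \<not> bad j})"
    by (subst card_lessThan[symmetric]) (rule arg_cong[where f = card], auto)
  also have "\<dots> \<le> card {j. j < 2 * J \<and> bad j} + card {j. j < 2 * J \<and> \<not> bad j}"
    by (rule card_Un_le)
  finally have "J \<le> card {j. j < 2 * J \<and> \<not> bad j}" using bad by linarith
  then show ?thesis by (simp add: bad_def not_less)
qed

text \<open>With \<open>t\<close> boundary edges off \<open>D\<close>, \<open>g\<close> steep edges and \<open>b\<close> shallow edges, the gain is at least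
  \<open>- t / 2 + t + 3 g - b\<close>, where \<open>- t / 2\<close> is the allowance for the flux; the assumption
  \<open>8 b \<le> t + g + b\<close> makes this at least \<open>(t + g + b) / 4\<close>.\<close>
lemma energy_gain:
  fixes \<phi> :: config and u :: "site \<Rightarrow> real"
  defines "\<psi> \<equiv> \<lambda>x. real_of_int (\<phi> x) - u x"
  assumes fin: "finite S"
    and good: "8 * card (shallow_edges \<psi> D S) \<le> card (out_edges S)"
    and level: "\<And>x y. (x, y) \<in> out_edges S \<Longrightarrow> \<psi> y < \<psi> x"
    and flat: "\<And>x y. adj x y \<Longrightarrow> x \<notin> D \<Longrightarrow> y \<notin> D \<Longrightarrow> u x = u y"
    and flux: "- (1 / 2) * card {(x, y) \<in> out_edges S. x \<notin> D \<and> y \<notin> D}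
      \<le> 2 * (\<Sum>(x, y)\<in>out_edges S. u x - u y)"
  shows "card (out_edges S) / 4 \<le> (\<Sum>(x, y)\<in>out_edges S. 2 * real_of_int (\<phi> x - \<phi> y) - 1)"
proof -
  let ?E = "out_edges S"
  define T where "T = {(x, y) \<in> ?E. x \<notin> D \<and> y \<notin> D}"
  define B where "B = shallow_edges \<psi> D S"
  define G where "G = ?E - T - B"
  have finE: "finite ?E" using fin by (rule finite_out_edges)
  have sub: "T \<subseteq> ?E" "B \<subseteq> ?E" "T \<inter> B = {}"
    by (auto simp: T_def B_def shallow_edges_def)
  have split: "sum g ?E = sum g T + sum g G + sum g B" for g :: "_ \<Rightarrow> real"
  proof -
    have "sum g ?E = sum g (?E - T) + sum g T"
      using sub finE by (intro sum.subset_diff) auto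
    also have "sum g (?E - T) = sum g (?E - T - B) + sum g B"
      using sub finE by (intro sum.subset_diff) auto
    finally show ?thesis by (simp add: G_def)
  qed
  have card: "real (card ?E) = card T + card G + card B"
    using split[of "\<lambda>_. 1"] by simp
  let ?\<delta> = "\<lambda>(x, y). 2 * (\<psi> x - \<psi> y) - 1"
  have "(\<Sum>e\<in>T. 1) \<le> sum ?\<delta> T"
  proof (rule sum_mono)
    fix e assume "e \<in> T"
    then obtain x y where e: "e = (x, y)" "(x, y) \<in> ?E" "x \<notin> D" "y \<notin> D" by (auto simp: T_def)
    then have "u x = u y" using flat by (auto simp: out_edges_def)
    then have "\<psi> x - \<psi> y = real_of_int (\<phi> x - \<phi> y)" "0 < \<psi> x - \<psi> y"
      using level[OF e(2)] by (auto simp: \<psi>_def)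
    then have "1 \<le> \<psi> x - \<psi> y"
      by (metis int_one_le_iff_zero_less of_int_0_less_iff of_int_1_le_iff)
    then show "1 \<le> ?\<delta> e" using e by simp
  qed
  moreover have "(\<Sum>e\<in>G. 3) \<le> sum ?\<delta> G"
    by (rule sum_mono) (auto simp: G_def T_def B_def shallow_edges_def)
  moreover have "(\<Sum>e\<in>B. -1) \<le> sum ?\<delta> B"
  proof (rule sum_mono)
    fix e assume "e \<in> B"
    then obtain x y where "e = (x, y)" "(x, y) \<in> ?E" by (auto simp: B_def shallow_edges_def)
    then show "-1 \<le> ?\<delta> e" using level[of x y] by simp
  qed
  ultimately have "real (card T) + 3 * card G - card B \<le> sum ?\<delta> ?E"
    unfolding split by simp
  moreover have "(\<Sum>(x, y)\<in>?E. 2 * real_of_int (\<phi> x - \<phi> y) - 1) = sum ?\<delta> ?E + 2 * (\<Sum>(x, y)\<in>?E. u x - u y)"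
    by (simp add: sum_distrib_left case_prod_beta \<psi>_def algebra_simps flip: sum.distrib)
  moreover have "8 * real (card B) \<le> card ?E"
    using good by (simp add: B_def)
  ultimately show ?thesis
    using flux card unfolding T_def[symmetric] by linarith
qed

section \<open>Peeling off one level\<close>

definition lower :: "site set \<Rightarrow> config \<Rightarrow> config" where
  "lower S \<phi> = (\<lambda>x. \<phi> x - of_bool (x \<in> S))"

lemma energy_lower:
  assumes "S \<subseteq> box M"
  shows "DG_energy M \<phi> - DG_energy M (lower S \<phi>) =
    (\<Sum>(x, y)\<in>out_edges S. 2 * real_of_int (\<phi> x - \<phi> y) - 1)"
proof -
  define P where "P = {(x, y). adj x y \<and> (x \<in> box M \<or> y \<in> box M)}"
  define e where "e = (\<lambda>(\<phi>::config) (x, y). (real_of_int \<bar>\<phi> x - \<phi> y\<bar>)\<^sup>2)"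
  define g where "g p = e \<phi> p - e (lower S \<phi>) p" for p
  have finS: "finite S" using assms finite_box finite_subset by blast
  note finE = finite_out_edges[OF finS]
  have finP: "finite P"
  proof (rule finite_subset)
    let ?A = "SIGMA x:box M. {y. adj x y}"
    show "P \<subseteq> ?A \<union> prod.swap ` ?A"
      by (auto simp: P_def image_iff adj_sym)
    show "finite (?A \<union> prod.swap ` ?A)"
      by (auto simp: finite_box finite_nbrs)
  qed
  have sub: "out_edges S \<union> prod.swap ` out_edges S \<subseteq> P"
    using assms by (auto simp: P_def out_edges_def adj_sym)
  have "sum g P = sum g (out_edges S \<union> prod.swap ` out_edges S)"
  proof (rule sum.mono_neutral_right[OF finP sub], rule ballI)
    fix p assume p: "p \<in> P - (out_edges S \<union> prod.swap ` out_edges S)"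
    obtain x y where xy: "p = (x, y)" by (cases p) auto
    have "(x \<in> S) = (y \<in> S)"
    proof (rule ccontr)
      assume "(x \<in> S) \<noteq> (y \<in> S)"
      moreover have "adj x y" "adj y x" using p by (auto simp: xy P_def adj_sym)
      ultimately have "(x, y) \<in> out_edges S \<or> (y, x) \<in> out_edges S"
        by (auto simp: out_edges_def)
      then have "p \<in> out_edges S \<union> prod.swap ` out_edges S"
        unfolding xy by (metis UnCI imageI swap_simp)
      with p show False by blast
    qed
    then show "g p = 0" by (auto simp: g_def e_def lower_def xy)
  qed
  also have "\<dots> = sum g (out_edges S) + sum g (prod.swap ` out_edges S)"
    using finE by (intro sum.union_disjoint) (auto simp: out_edges_def)
  also have "sum g (prod.swap ` out_edges S) = sum (g \<circ> prod.swap) (out_edges S)"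
    by (intro sum.reindex) simp
  also have "sum (g \<circ> prod.swap) (out_edges S) = sum g (out_edges S)"
    by (intro sum.cong) (auto simp: g_def e_def power2_commute)
  also have "sum g (out_edges S) = (\<Sum>(x, y)\<in>out_edges S. 2 * real_of_int (\<phi> x - \<phi> y) - 1)"
    by (intro sum.cong) (auto simp: g_def e_def lower_def out_edges_def power2_eq_square algebra_simps)
  finally have "sum g P = 2 * (\<Sum>(x, y)\<in>out_edges S. 2 * real_of_int (\<phi> x - \<phi> y) - 1)"
    by simp
  moreover have "DG_energy M \<phi> - DG_energy M (lower S \<phi>) = sum g P / 2"
    unfolding DG_energy_def P_def[symmetric] g_def sum_subtractf
    by (simp add: e_def case_prod_beta diff_divide_distrib)
  ultimately show ?thesis by simp
qed

text \<open>The finite-volume probability as a sum over configurations in \<^typ>\<open>ennreal\<close>. The Peierls inequalities hold between such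
  sums whether or not they are finite; finiteness enters only in the limit.\<close>
definition box_mass :: "real \<Rightarrow> nat \<Rightarrow> config set \<Rightarrow> ennreal" where
  "box_mass \<beta> M A =
    (\<integral>\<^sup>+\<phi>. ennreal (DG_weight \<beta> M \<phi> / DG_partition \<beta> M) * indicator A \<phi> \<partial>count_space (box_configs M))"

lemma emeasure_DG_box:
  assumes "A \<in> sets borel"
  shows "emeasure (DG_box \<beta> M) A = box_mass \<beta> M A"
proof -
  let ?p = "\<lambda>\<phi>. ennreal (DG_weight \<beta> M \<phi> / DG_partition \<beta> M)"
  have "emeasure (DG_box \<beta> M) A = emeasure (point_measure (box_configs M) ?p) (A \<inter> box_configs M)"
    unfolding DG_box_def using assms
    by (subst emeasure_distr) (auto simp: measurable_def sets_point_measure space_point_measure)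
  also have "\<dots> = (\<integral>\<^sup>+\<phi>. ?p \<phi> * indicator (A \<inter> box_configs M) \<phi> \<partial>count_space (box_configs M))"
    unfolding point_measure_def by (intro emeasure_density) auto
  also have "\<dots> = box_mass \<beta> M A"
    unfolding box_mass_def by (intro nn_integral_cong) (auto simp: indicator_def)
  finally show ?thesis .
qed

lemma box_mass_mono:
  assumes "\<And>\<phi>. \<phi> \<in> box_configs M \<Longrightarrow> \<phi> \<in> A \<Longrightarrow> \<phi> \<in> B"
  shows "box_mass \<beta> M A \<le> box_mass \<beta> M B"
  unfolding box_mass_def using assms
  by (intro nn_integral_mono) (auto simp: indicator_def)

lemma bij_lower:
  assumes "S \<subseteq> box M"
  shows "bij_betw (lower S) (box_configs M) (box_configs M)"
  by (rule bij_betw_byWitness[where f' = "\<lambda>\<phi> x. \<phi> x + of_bool (x \<in> S)"])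
    (use assms in \<open>auto simp: lower_def box_configs_def\<close>)

lemma partition_nonneg: "0 \<le> DG_partition \<beta> M"
  unfolding DG_partition_def by (rule infsum_nonneg) (simp add: DG_weight_def)

text \<open>For a fixed region \<open>S\<close> the map \<open>lower S\<close> is a bijection of the box configurations, so no configuration is
  counted twice.\<close>
lemma box_mass_lower:
  assumes \<beta>: "0 \<le> \<beta>" and S: "S \<subseteq> box M"
    and maps: "\<And>\<phi>. \<phi> \<in> box_configs M \<Longrightarrow> \<phi> \<in> A \<Longrightarrow> lower S \<phi> \<in> B"
    and gain: "\<And>\<phi>. \<phi> \<in> box_configs M \<Longrightarrow> \<phi> \<in> A \<Longrightarrow>
      c \<le> (\<Sum>(x, y)\<in>out_edges S. 2 * real_of_int (\<phi> x - \<phi> y) - 1)"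
  shows "box_mass \<beta> M A \<le> ennreal (exp (- \<beta> * c)) * box_mass \<beta> M B"
proof -
  let ?C = "box_configs M"
  let ?p = "\<lambda>\<phi>. ennreal (DG_weight \<beta> M \<phi> / DG_partition \<beta> M)"
  have "box_mass \<beta> M A \<le>
    (\<integral>\<^sup>+\<phi>. ennreal (exp (- \<beta> * c)) * (?p (lower S \<phi>) * indicator B (lower S \<phi>)) \<partial>count_space ?C)"
    unfolding box_mass_def
  proof (rule nn_integral_mono)
    fix \<phi> assume "\<phi> \<in> space (count_space ?C)"
    then have \<phi>: "\<phi> \<in> ?C" by simp
    show "?p \<phi> * indicator A \<phi> \<le> ennreal (exp (- \<beta> * c)) * (?p (lower S \<phi>) * indicator B (lower S \<phi>))"
    proof (cases "\<phi> \<in> A")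
      case True
      have "\<beta> * c \<le> \<beta> * (DG_energy M \<phi> - DG_energy M (lower S \<phi>))"
        using gain[OF \<phi> True] \<beta> by (intro mult_left_mono) (simp_all add: energy_lower[OF S])
      then have "DG_weight \<beta> M \<phi> \<le> exp (- \<beta> * c) * DG_weight \<beta> M (lower S \<phi>)"
        by (simp add: DG_weight_def algebra_simps flip: exp_add)
      then have "DG_weight \<beta> M \<phi> / DG_partition \<beta> M
          \<le> exp (- \<beta> * c) * (DG_weight \<beta> M (lower S \<phi>) / DG_partition \<beta> M)"
        using divide_right_mono[OF _ partition_nonneg] by fastforce
      then have "?p \<phi> \<le> ennreal (exp (- \<beta> * c) * (DG_weight \<beta> M (lower S \<phi>) / DG_partition \<beta> M))"
        by (rule ennreal_leI)
      also have "\<dots> = ennreal (exp (- \<beta> * c)) * ?p (lower S \<phi>)"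
        by (rule ennreal_mult') simp
      finally have "?p \<phi> \<le> ennreal (exp (- \<beta> * c)) * ?p (lower S \<phi>)" .
      then show ?thesis using True maps[OF \<phi> True] by simp
    qed simp
  qed
  also have "\<dots> = ennreal (exp (- \<beta> * c)) * (\<integral>\<^sup>+\<phi>. ?p (lower S \<phi>) * indicator B (lower S \<phi>) \<partial>count_space ?C)"
    by (rule nn_integral_cmult) simp
  also have "(\<integral>\<^sup>+\<phi>. ?p (lower S \<phi>) * indicator B (lower S \<phi>) \<partial>count_space ?C) = box_mass \<beta> M B"
    unfolding box_mass_def
    by (rule nn_integral_bij_count_space[OF bij_lower[OF S], of "\<lambda>\<phi>. ?p \<phi> * indicator B \<phi>"])
  finally show ?thesis .
qed

definition pinned :: "site set \<Rightarrow> int \<Rightarrow> config set" where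
  "pinned B \<kappa> = {\<phi>. \<forall>x\<in>B. \<phi> x = \<kappa>}"

text \<open>A reference function \<open>u\<close> for fields pinned to \<open>\<kappa>\<close> on \<open>B\<close>. The excess over \<open>u\<close> is at most \<open>0\<close> on \<open>B\<close> and off the box, so
  regions of positive excess avoid both. Off \<open>D\<close> the function is locally constant, so that the excess drops by
  integers there. The last clause is an approximate superharmonicity: the flux of \<open>u\<close> out of \<open>S\<close> may be negative by
  at most \<open>1 / 4\<close> per boundary edge off \<open>D\<close>; such an edge gains at least \<open>1\<close>, twice what the doubled flux
  takes away.\<close>
definition barrier :: "site set \<Rightarrow> int \<Rightarrow> site set \<Rightarrow> nat \<Rightarrow> (site \<Rightarrow> real) \<Rightarrow> bool" where
  "barrier B \<kappa> D N u \<longleftrightarrow>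
     (\<forall>x\<in>B. real_of_int \<kappa> \<le> u x) \<and>
     (\<forall>x. x \<notin> box N \<longrightarrow> 0 \<le> u x) \<and>
     (\<forall>x y. adj x y \<and> (x \<in> D \<or> y \<in> D) \<longrightarrow> x \<in> box N) \<and>
     (\<forall>x y. adj x y \<and> x \<notin> D \<and> y \<notin> D \<longrightarrow> u x = u y) \<and>
     (\<forall>S. finite S \<and> S \<inter> B = {} \<longrightarrow>
        - (1 / 2) * card {(x, y) \<in> out_edges S. x \<notin> D \<and> y \<notin> D} \<le> 2 * (\<Sum>(x, y)\<in>out_edges S. u x - u y))"

text \<open>All levels \<open>2 j\<close> with \<open>j < 2 J\<close> lie below the excess at \<open>z\<close>, and the pinned set lies in the inner obstacle of
  every level because it is connected and contains the origin.\<close>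
lemma many_good_regions:
  fixes u :: "site \<Rightarrow> real" and z :: site and M :: nat
  defines "reg \<equiv> \<lambda>\<phi> j. excess_region {x. real_of_int (\<phi> x) - u x \<le> 2 * real j} (int M + 1, 0) z"
  assumes B: "connected_sites B" "(0, 0) \<in> B" and u: "barrier B \<kappa> D N u" and NM: "N \<le> M"
    and J: "J = 16 * (2 * N + 1)"
    and \<phi>: "\<phi> \<in> box_configs M" "\<phi> \<in> pinned B \<kappa>" and z: "u z + 4 * real J < real_of_int (\<phi> z)"
  shows "J \<le> card {j. j < 2 * J \<and> reg \<phi> j \<in> contours M z \<union> ring_regions M z \<and> reg \<phi> j \<inter> B = {} \<and>
      card (out_edges (reg \<phi> j)) / 4 \<le> (\<Sum>(x, y)\<in>out_edges (reg \<phi> j). 2 * real_of_int (\<phi> x - \<phi> y) - 1)}"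
    (is "_ \<le> card ?G")
proof -
  define \<psi> where "\<psi> x = real_of_int (\<phi> x) - u x" for x
  define L where "L j = {x. \<psi> x \<le> 2 * real j}" for j :: nat
  have reg: "reg \<phi> j = excess_region (L j) (int M + 1, 0) z" for j
    by (simp add: reg_def L_def \<psi>_def)
  have u': "\<And>x. x \<in> B \<Longrightarrow> real_of_int \<kappa> \<le> u x" "\<And>x. x \<notin> box N \<Longrightarrow> 0 \<le> u x"
    "\<And>x y. adj x y \<Longrightarrow> x \<in> D \<or> y \<in> D \<Longrightarrow> x \<in> box N"
    "\<And>x y. adj x y \<Longrightarrow> x \<notin> D \<Longrightarrow> y \<notin> D \<Longrightarrow> u x = u y"
    "\<And>S. finite S \<Longrightarrow> S \<inter> B = {} \<Longrightarrow>
        - (1 / 2) * card {(x, y) \<in> out_edges S. x \<notin> D \<and> y \<notin> D} \<le> 2 * (\<Sum>(x, y)\<in>out_edges S. u x - u y)"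
    using u unfolding barrier_def by blast+
  have f: "(int M + 1, 0) \<notin> box M" by (simp add: box_def)
  have out: "- box M \<subseteq> L j" for j
  proof
    fix x assume "x \<in> - box M"
    then have "x \<notin> box M" "x \<notin> box N" using NM by (auto simp: box_def)
    moreover from this have "\<phi> x = 0" using \<phi>(1) unfolding box_configs_def by blast
    ultimately show "x \<in> L j" using u'(2)[of x] by (simp add: L_def \<psi>_def)
  qed
  have BL: "B \<subseteq> L j" for j
    using \<phi>(2) u'(1) by (force simp: L_def \<psi>_def pinned_def)
  then have zero: "(0, 0) \<in> L j" for j using B by blast
  have zL: "z \<notin> L j" if "j \<le> 2 * J" for j
    using that z by (auto simp: L_def \<psi>_def)
  note facts = f out zero zL
  \<comment> \<open>Beyond the relevant levels \<open>z\<close> may fall below the level; empty sets keep the family decreasing.\<close>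
  define S where "S j = (if j < 2 * J then reg \<phi> j else {})" for j
  have sub: "reg \<phi> j \<subseteq> box M" "reg \<phi> j \<inter> B = {}" if "j < 2 * J" for j
  proof -
    have "B \<subseteq> component (L j) (0, 0)"
      using B BL by (intro connected_subset_component_self) auto
    then show "reg \<phi> j \<subseteq> box M" "reg \<phi> j \<inter> B = {}"
      using excess_region_subset[OF f out[of j] zero zL] that unfolding reg by auto
  qed
  have finS: "finite (S j)" for j
    using sub(1)[of j] finite_subset[OF _ finite_box[of M]] by (auto simp: S_def)
  have dec: "S (Suc j) \<subseteq> S j" for j
  proof -
    have "L j \<subseteq> L (Suc j)" by (auto simp: L_def)
    from excess_region_antimono[OF this, of "(int M + 1, 0)" z] show ?thesis
      unfolding S_def reg by simp
  qed
  have level: "2 * real j < \<psi> x \<and> \<psi> y \<le> 2 * real j" if "(x, y) \<in> out_edges (S j)" for j x y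
  proof -
    have j: "j < 2 * J" using that by (auto simp: S_def out_edges_def split: if_splits)
    then have "(x, y) \<in> out_edges (excess_region (L j) (int M + 1, 0) z)"
      using that by (simp add: S_def reg)
    from excess_region_boundary[OF f out zero zL this] j show ?thesis
      by (auto simp: L_def)
  qed
  have "J \<le> card {j. j < 2 * J \<and> 8 * card (shallow_edges \<psi> D (S j)) \<le> card (out_edges (S j))}"
    by (rule good_levels[of S \<psi> D N, OF finS dec level u'(3) J])
  also have "\<dots> \<le> card ?G"
  proof (intro card_mono subsetI)
    fix j assume j: "j \<in> {j. j < 2 * J \<and> 8 * card (shallow_edges \<psi> D (S j)) \<le> card (out_edges (S j))}"
    then have Sj: "S j = reg \<phi> j" "j < 2 * J" by (auto simp: S_def)
    have "card (out_edges (S j)) / 4 \<le> (\<Sum>(x, y)\<in>out_edges (S j). 2 * real_of_int (\<phi> x - \<phi> y) - 1)"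
    proof (rule energy_gain[OF finS])
      show "8 * card (shallow_edges (\<lambda>x. real_of_int (\<phi> x) - u x) D (S j)) \<le> card (out_edges (S j))"
        using j unfolding \<psi>_def by blast
      show "real_of_int (\<phi> y) - u y < real_of_int (\<phi> x) - u x" if "(x, y) \<in> out_edges (S j)" for x y
        using level[OF that] unfolding \<psi>_def by linarith
      show "- (1 / 2) * real (card {(x, y) \<in> out_edges (S j). x \<notin> D \<and> y \<notin> D})
          \<le> 2 * (\<Sum>(x, y)\<in>out_edges (S j). u x - u y)"
        using sub(2)[of j] Sj by (intro u'(5) finS) simp
    qed (rule u'(4))
    moreover have "reg \<phi> j \<in> contours M z \<union> ring_regions M z"
      unfolding reg using Sj by (intro excess_region_shape facts) auto
    ultimately show "j \<in> ?G" using Sj sub(2) by auto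
  qed auto
  finally show ?thesis .
qed

definition excess :: "(site \<Rightarrow> real) \<Rightarrow> site \<Rightarrow> real \<Rightarrow> config set" where
  "excess u z t = {\<phi>. u z + t < real_of_int (\<phi> z)}"

text \<open>The sum over the levels of the indicators of good regions is at least \<open>J\<close> on the event on the left; this
  replaces the choice of a good level by an average over \<open>2 J\<close> levels. For each level and region the event is
  mapped injectively into the event on the right, since the region contains \<open>z\<close>. For
  \<open>\<beta> \<ge> 4 ln 5184\<close> the ratio \<open>2592 exp (- \<beta> / 4)\<close> in the sum over the regions is at most \<open>1 / 2\<close>.\<close>
lemma peel_one_level:
  assumes \<beta>: "4 * ln 5184 \<le> \<beta>"
    and B: "connected_sites B" "(0, 0) \<in> B" and u: "barrier B \<kappa> D N u" and NM: "N \<le> M"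
    and t: "64 * (2 * real N + 1) \<le> t"
  shows "box_mass \<beta> M (pinned B \<kappa> \<inter> excess u z (t + 1))
    \<le> ennreal (exp (4 * ln 5184 - \<beta>)) * box_mass \<beta> M (pinned B \<kappa> \<inter> excess u z t)"
proof -
  define J where "J = 16 * (2 * N + 1)"
  define reg where "reg \<phi> j = excess_region {x. real_of_int (\<phi> x) - u x \<le> 2 * real j} (int M + 1, 0) z"
    for \<phi> :: config and j :: nat
  let ?C = "box_configs M" and ?\<S> = "contours M z \<union> ring_regions M z"
  let ?p = "\<lambda>\<phi>. ennreal (DG_weight \<beta> M \<phi> / DG_partition \<beta> M)"
  let ?A = "pinned B \<kappa> \<inter> excess u z (t + 1)" and ?A' = "pinned B \<kappa> \<inter> excess u z t"
  define gain where "gain \<phi> S = (\<Sum>(x, y)\<in>out_edges S. 2 * real_of_int (\<phi> x - \<phi> y) - 1)"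
    for \<phi> :: config and S
  define X where "X j S = {\<phi> \<in> ?A. reg \<phi> j = S \<and> S \<inter> B = {} \<and> card (out_edges S) / 4 \<le> gain \<phi> S}" for j S
  define q where "q = exp (- \<beta> / 4)"
  have fin\<S>: "finite ?\<S>" by (simp add: finite_contours finite_ring_regions)
  have sub\<S>: "z \<in> S \<Longrightarrow> S \<subseteq> box M" if "S \<in> ?\<S>" for S
    using that by (auto simp: contours_def ring_regions_def)
  have pointwise: "of_nat J * indicator ?A \<phi> \<le> (\<Sum>j<2 * J. \<Sum>S\<in>?\<S>. indicator (X j S) \<phi> :: ennreal)"
    if \<phi>: "\<phi> \<in> ?C" for \<phi>
  proof (cases "\<phi> \<in> ?A")
    case True
    define G where "G = {j. j < 2 * J \<and> reg \<phi> j \<in> ?\<S> \<and> reg \<phi> j \<inter> B = {} \<and>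
      card (out_edges (reg \<phi> j)) / 4 \<le> gain \<phi> (reg \<phi> j)}"
    have "u z + 4 * real J < real_of_int (\<phi> z)"
      using True t by (simp add: excess_def J_def)
    then have "J \<le> card G"
      unfolding G_def reg_def gain_def
      using True by (intro many_good_regions[OF B u NM J_def \<phi>]) auto
    then have "of_nat J * indicator ?A \<phi> \<le> (of_nat (card G) :: ennreal)"
      using True by simp
    also have "\<dots> = (\<Sum>j\<in>G. 1)" by simp
    also have "\<dots> \<le> (\<Sum>j\<in>G. \<Sum>S\<in>?\<S>. indicator (X j S) \<phi>)"
    proof (rule sum_mono)
      fix j assume j: "j \<in> G"
      then have "(1 :: ennreal) = indicator (X j (reg \<phi> j)) \<phi>"
        using True by (simp add: G_def X_def)
      also have "\<dots> \<le> (\<Sum>S\<in>?\<S>. indicator (X j S) \<phi>)"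
        using j fin\<S> by (intro member_le_sum) (auto simp: G_def)
      finally show "1 \<le> (\<Sum>S\<in>?\<S>. indicator (X j S) \<phi> :: ennreal)" .
    qed
    also have "\<dots> \<le> (\<Sum>j<2 * J. \<Sum>S\<in>?\<S>. indicator (X j S) \<phi>)"
      by (intro sum_mono2) (auto simp: G_def)
    finally show ?thesis .
  qed simp
  have each: "box_mass \<beta> M (X j S) \<le> ennreal (q ^ card (out_edges S)) * box_mass \<beta> M ?A'" if S: "S \<in> ?\<S>" for j S
  proof (cases "z \<in> S \<and> S \<inter> B = {}")
    case True
    have "box_mass \<beta> M (X j S) \<le> ennreal (exp (- \<beta> * (card (out_edges S) / 4))) * box_mass \<beta> M ?A'"
    proof (rule box_mass_lower)
      show "0 \<le> \<beta>" using \<beta> ln_ge_zero[of 5184] by linarith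
      show "S \<subseteq> box M" using sub\<S>[OF S] True by blast
      show "lower S \<phi> \<in> ?A'" if "\<phi> \<in> X j S" for \<phi>
        using that True by (auto simp: X_def lower_def pinned_def excess_def)
      show "real (card (out_edges S)) / 4 \<le> (\<Sum>(x, y)\<in>out_edges S. 2 * real_of_int (\<phi> x - \<phi> y) - 1)"
        if "\<phi> \<in> X j S" for \<phi>
        using that by (simp add: X_def gain_def)
    qed
    also have "exp (- \<beta> * (card (out_edges S) / 4)) = q ^ card (out_edges S)"
      by (simp add: q_def mult.commute flip: exp_of_nat_mult)
    finally show ?thesis .
  next
    case False
    have "z \<in> reg \<phi> j" for \<phi>
      by (simp add: reg_def excess_region_def)
    then have "X j S = {}" using False by (auto simp: X_def)
    then show ?thesis by (simp add: box_mass_def)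
  qed
  have "of_nat J * box_mass \<beta> M ?A = (\<integral>\<^sup>+\<phi>. ?p \<phi> * (of_nat J * indicator ?A \<phi>) \<partial>count_space ?C)"
    unfolding box_mass_def by (subst nn_integral_cmult[symmetric]) (auto simp: mult_ac intro!: nn_integral_cong)
  also have "\<dots> \<le> (\<integral>\<^sup>+\<phi>. ?p \<phi> * (\<Sum>j<2 * J. \<Sum>S\<in>?\<S>. indicator (X j S) \<phi>) \<partial>count_space ?C)"
    using pointwise by (intro nn_integral_mono mult_left_mono) auto
  also have "\<dots> = (\<integral>\<^sup>+\<phi>. (\<Sum>j<2 * J. \<Sum>S\<in>?\<S>. ?p \<phi> * indicator (X j S) \<phi>) \<partial>count_space ?C)"
    by (simp add: sum_distrib_left)
  also have "\<dots> = (\<Sum>j<2 * J. \<Sum>S\<in>?\<S>. box_mass \<beta> M (X j S))"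
    unfolding box_mass_def by (subst nn_integral_sum; (subst nn_integral_sum)?; simp)
  also have "\<dots> \<le> (\<Sum>j<2 * J. \<Sum>S\<in>?\<S>. ennreal (q ^ card (out_edges S)) * box_mass \<beta> M ?A')"
    using each by (intro sum_mono) auto
  also have "\<dots> = of_nat (2 * J) * (ennreal (\<Sum>S\<in>?\<S>. q ^ card (out_edges S)) * box_mass \<beta> M ?A')"
    by (simp add: sum_distrib_right q_def flip: sum_ennreal)
  also have "\<dots> \<le> of_nat (2 * J) * (ennreal (4 * (2592 * q) ^ 4) * box_mass \<beta> M ?A')"
  proof (intro mult_left_mono mult_right_mono ennreal_leI region_sum)
    have "- \<beta> / 4 \<le> - ln 5184" using \<beta> by simp
    then have "q \<le> exp (- ln 5184)" by (simp only: q_def exp_le_cancel_iff)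
    then show "2592 * q \<le> 1 / 2" by (simp add: exp_minus)
  qed (simp_all add: q_def)
  also have "\<dots> = of_nat J * (ennreal (8 * (2592 * q) ^ 4) * box_mass \<beta> M ?A')"
  proof -
    have "ennreal (8 * (2592 * q) ^ 4) = ennreal 2 * ennreal (4 * (2592 * q) ^ 4)"
      by (subst ennreal_mult'[symmetric]) simp_all
    then have "ennreal (8 * (2592 * q) ^ 4) = 2 * ennreal (4 * (2592 * q) ^ 4)"
      by (simp only: ennreal_numeral zero_le_numeral)
    then show ?thesis by (simp add: mult_ac)
  qed
  finally have "box_mass \<beta> M ?A \<le> ennreal (8 * (2592 * q) ^ 4) * box_mass \<beta> M ?A'"
  proof (rule iffD1[OF ennreal_mult_le_mult_iff, rotated 2])
    show "of_nat J \<noteq> (0 :: ennreal)" by (simp add: J_def)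
    show "of_nat J \<noteq> (top :: ennreal)" by (rule ennreal_of_nat_neq_top)
  qed
  also have "\<dots> \<le> ennreal (exp (4 * ln 5184 - \<beta>)) * box_mass \<beta> M ?A'"
  proof (intro mult_right_mono ennreal_leI)
    have "q ^ 4 = exp (- \<beta>)"
      by (simp add: q_def flip: exp_of_nat_mult)
    moreover have "exp (4 * ln 5184) = (5184 :: real) ^ 4"
      using exp_of_nat_mult[of 4 "ln 5184 :: real"] by simp
    ultimately show "8 * (2592 * q) ^ 4 \<le> exp (4 * ln 5184 - \<beta>)"
      by (simp add: exp_diff exp_minus power_mult_distrib field_simps)
  qed simp
  finally show ?thesis .
qed

lemma excess_tail:
  assumes \<beta>: "4 * ln 5184 \<le> \<beta>"
    and B: "connected_sites B" "(0, 0) \<in> B" and u: "barrier B \<kappa> D N u" and NM: "N \<le> M"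
    and t: "64 * (2 * real N + 1) + real k \<le> t"
  shows "box_mass \<beta> M (pinned B \<kappa> \<inter> excess u z t)
    \<le> ennreal (exp (4 * ln 5184 - \<beta>) ^ k) * box_mass \<beta> M (pinned B \<kappa>)"
  using t
proof (induction k arbitrary: t)
  case 0
  then show ?case by (auto intro: box_mass_mono)
next
  case (Suc k)
  let ?\<rho> = "exp (4 * ln 5184 - \<beta>)"
  have "box_mass \<beta> M (pinned B \<kappa> \<inter> excess u z t)
      \<le> ennreal ?\<rho> * box_mass \<beta> M (pinned B \<kappa> \<inter> excess u z (t - 1))"
    using peel_one_level[OF \<beta> B u NM, of "t - 1" z] Suc.prems by simp
  also have "\<dots> \<le> ennreal ?\<rho> * (ennreal (?\<rho> ^ k) * box_mass \<beta> M (pinned B \<kappa>))"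
    using Suc.prems by (intro mult_left_mono Suc.IH) auto
  also have "\<dots> = ennreal (?\<rho> ^ Suc k) * box_mass \<beta> M (pinned B \<kappa>)"
    by (simp add: ennreal_mult' mult.assoc)
  finally show ?case .
qed

section \<open>The harmonic profile is a barrier\<close>

text \<open>Among the maximum points choose one that is farthest to the right: by the mean value inequality its right
  neighbour is a maximum point as well.\<close>
lemma discrete_maximum_principle:
  fixes v :: "site \<Rightarrow> real"
  assumes fin: "finite A"
    and sub: "\<And>x. x \<in> A \<Longrightarrow> 4 * v x \<le> (\<Sum>y | adj x y. v y)"
    and bd: "\<And>x y. x \<in> A \<Longrightarrow> adj x y \<Longrightarrow> y \<notin> A \<Longrightarrow> v y \<le> 0"
    and x: "x \<in> A"
  shows "v x \<le> 0"
proof (rule ccontr)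
  assume pos: "\<not> v x \<le> 0"
  define m where "m = Max (v ` A)"
  have m: "v y \<le> m" if "y \<in> A" for y
    unfolding m_def using fin that by simp
  have m0: "0 < m" using m[OF x] pos by simp
  define T where "T = {y \<in> A. v y = m}"
  have "m \<in> v ` A" unfolding m_def using fin x by (intro Max_in) auto
  then have T: "finite T" "T \<noteq> {}" using fin by (auto simp: T_def)
  then have "Max (fst ` T) \<in> fst ` T" by (intro Max_in) auto
  then obtain p where p: "p \<in> T" "fst p = Max (fst ` T)" by auto
  let ?q = "(fst p + 1, snd p)"
  have pq: "adj p ?q" by (simp add: adj_iff)
  have pA: "p \<in> A" using p by (simp add: T_def)
  have le: "v y \<le> m" if "adj p y" for y
    using m[of y] bd[OF pA that] m0 by (cases "y \<in> A") auto
  have "4 * m \<le> (\<Sum>y | adj p y. v y)" using sub[OF pA] p by (simp add: T_def)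
  also have "\<dots> = v ?q + (\<Sum>y\<in>{y. adj p y} - {?q}. v y)"
    using pq by (intro sum.remove finite_nbrs) simp
  also have "\<dots> \<le> v ?q + (\<Sum>y\<in>{y. adj p y} - {?q}. m)"
    using le by (intro add_left_mono sum_mono) auto
  also have "\<dots> = v ?q + 3 * m"
    using pq finite_nbrs[of p] by (simp add: card_Diff_singleton card_nbrs)
  finally have "m \<le> v ?q" by simp
  then have "v ?q = m" using le[OF pq] by simp
  moreover have "?q \<in> A" using bd[OF pA pq] \<open>m \<le> v ?q\<close> m0 by force
  ultimately have "?q \<in> T" by (simp add: T_def)
  then have "fst ?q \<le> Max (fst ` T)" using T by (intro Max_ge imageI finite_imageI)
  then have "fst p + 1 \<le> fst p" unfolding p(2)[symmetric] fst_conv .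
  then show False by simp
qed

definition nrm :: "site \<Rightarrow> real" where
  "nrm x = sqrt ((real_of_int (fst x))\<^sup>2 + (real_of_int (snd x))\<^sup>2)"

lemma lball_iff: "x \<in> lball s \<longleftrightarrow> nrm x \<le> s"
  by (simp add: lball_def nrm_def)

lemma nrm_sq: "(nrm x)\<^sup>2 = (real_of_int (fst x))\<^sup>2 + (real_of_int (snd x))\<^sup>2"
  by (simp add: nrm_def)

lemma nrm_nonneg [simp]: "0 \<le> nrm x"
  by (simp add: nrm_def)

lemma nrm_adj: "adj x y \<Longrightarrow> nrm y \<le> nrm x + 1"
proof -
  assume xy: "adj x y"
  let ?e = "\<lambda>x. (real_of_int (fst x), real_of_int (snd x))"
  have n: "nrm x = norm (?e x)" for x
    by (simp add: nrm_def norm_Pair)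
  have "norm (?e y - ?e x) = 1"
    using xy by (auto simp: adj_iff norm_Pair)
  then show ?thesis
    unfolding n using norm_triangle_ineq2[of "?e y" "?e x"] by simp
qed

lemma abs_coords_le_nrm: "\<bar>real_of_int (fst x)\<bar> \<le> nrm x" "\<bar>real_of_int (snd x)\<bar> \<le> nrm x"
  unfolding nrm_def by (auto intro: real_le_rsqrt)

lemma lball_subset_box: "lball (real n) \<subseteq> box n"
proof
  fix x assume "x \<in> lball (real n)"
  then have "\<bar>real_of_int (fst x)\<bar> \<le> real n" "\<bar>real_of_int (snd x)\<bar> \<le> real n"
    using abs_coords_le_nrm[of x] by (auto simp: lball_iff)
  then have "\<bar>fst x\<bar> \<le> int n" "\<bar>snd x\<bar> \<le> int n" by linarith+
  then show "x \<in> box n" by (cases x) (auto simp: box_def)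
qed

lemma finite_lball: "finite (lball s)"
proof (rule finite_subset)
  have "lball s \<subseteq> lball (real (nat \<lceil>s\<rceil>))"
    by (auto simp: lball_iff intro: order_trans[OF _ real_nat_ceiling_ge])
  then show "lball s \<subseteq> box (nat \<lceil>s\<rceil>)" using lball_subset_box by blast
qed (rule finite_box)

lemma connected_lball:
  assumes "0 \<le> s"
  shows "connected_sites (lball s)"
proof -
  have to0: "joined (lball s) x (0, 0)" if "x \<in> lball s" for x
    using that
  proof (induction "nat (\<bar>fst x\<bar> + \<bar>snd x\<bar>)" arbitrary: x rule: less_induct)
    case less
    have shrink: "joined (lball s) x (0, 0)"
      if "adj x y" "\<bar>fst y\<bar> + \<bar>snd y\<bar> < \<bar>fst x\<bar> + \<bar>snd x\<bar>" "\<bar>fst y\<bar> \<le> \<bar>fst x\<bar>" "\<bar>snd y\<bar> \<le> \<bar>snd x\<bar>" for y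
    proof -
      have "\<bar>real_of_int (fst y)\<bar> \<le> \<bar>real_of_int (fst x)\<bar>" "\<bar>real_of_int (snd y)\<bar> \<le> \<bar>real_of_int (snd x)\<bar>"
        using that(3,4) by linarith+
      then have "(real_of_int (fst y))\<^sup>2 \<le> (real_of_int (fst x))\<^sup>2" "(real_of_int (snd y))\<^sup>2 \<le> (real_of_int (snd x))\<^sup>2"
        by (simp_all only: abs_le_square_iff)
      then have "nrm y \<le> nrm x" by (simp add: nrm_def)
      then have y: "y \<in> lball s" using less.prems by (simp add: lball_iff)
      then have "joined (lball s) y (0, 0)"
        using that(2) by (intro less.hyps) auto
      then show ?thesis using joined_step[OF that(1) less.prems y] joined_trans by blast
    qed
    consider "0 < fst x" | "fst x < 0" | "0 < snd x" | "snd x < 0" | "x = (0, 0)"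
      by (cases x) force
    then show ?case
    proof cases
      case 1 then show ?thesis by (intro shrink[of "(fst x - 1, snd x)"]) (auto simp: adj_iff)
    next
      case 2 then show ?thesis by (intro shrink[of "(fst x + 1, snd x)"]) (auto simp: adj_iff)
    next
      case 3 then show ?thesis by (intro shrink[of "(fst x, snd x - 1)"]) (auto simp: adj_iff)
    next
      case 4 then show ?thesis by (intro shrink[of "(fst x, snd x + 1)"]) (auto simp: adj_iff)
    qed simp
  qed
  then show ?thesis
    unfolding connected_sites_def by (intro ballI joined_trans[OF to0 joined_sym[OF to0]])
qed

lemma sum_nbrs:
  "(\<Sum>y | adj x y. g y) = g (fst x + 1, snd x) + g (fst x - 1, snd x) + g (fst x, snd x + 1) + g (fst x, snd x - 1)"
  for g :: "site \<Rightarrow> real"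
  by (simp add: nbrs_eq)

text \<open>The continuous function \<open>ln (\<bar>x\<bar>\<^sup>2)\<close> is harmonic off the origin, but its lattice Laplacian has no sign; the shift by \<open>1 / 2\<close> adds
  enough mass to make it subharmonic on the whole lattice. After exponentiating, the inequality compares a product of four
  polynomials with \<open>q ^ 4\<close>, and the difference is a sum of nonnegative terms.\<close>
lemma log_subharmonic:
  "4 * ln ((nrm x)\<^sup>2 + 1 / 2) \<le> (\<Sum>y | adj x y. ln ((nrm y)\<^sup>2 + 1 / 2))"
proof -
  define a b where "a = real_of_int (fst x)" and "b = real_of_int (snd x)"
  define q where "q = a\<^sup>2 + b\<^sup>2 + 1 / 2"
  have q: "0 < q" by (simp add: q_def add_nonneg_pos)
  have pos: "0 < (a + 1)\<^sup>2 + b\<^sup>2 + 1 / 2" "0 < (a - 1)\<^sup>2 + b\<^sup>2 + 1 / 2"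
    "0 < a\<^sup>2 + (b + 1)\<^sup>2 + 1 / 2" "0 < a\<^sup>2 + (b - 1)\<^sup>2 + 1 / 2"
    by (auto intro: add_nonneg_pos)
  have ab: "a\<^sup>2 + b\<^sup>2 = q - 1 / 2" by (simp add: q_def)
  have "((a + 1)\<^sup>2 + b\<^sup>2 + 1 / 2) * ((a - 1)\<^sup>2 + b\<^sup>2 + 1 / 2) * (a\<^sup>2 + (b + 1)\<^sup>2 + 1 / 2) * (a\<^sup>2 + (b - 1)\<^sup>2 + 1 / 2)
    = (q + 1 + 2 * a) * (q + 1 - 2 * a) * (q + 1 + 2 * b) * (q + 1 - 2 * b)"
  proof -
    have "(a + 1)\<^sup>2 + b\<^sup>2 + 1 / 2 = q + 1 + 2 * a" "(a - 1)\<^sup>2 + b\<^sup>2 + 1 / 2 = q + 1 - 2 * a"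
      "a\<^sup>2 + (b + 1)\<^sup>2 + 1 / 2 = q + 1 + 2 * b" "a\<^sup>2 + (b - 1)\<^sup>2 + 1 / 2 = q + 1 - 2 * b"
      by (simp_all add: q_def power2_sum power2_diff)
    then show ?thesis by (simp only:)
  qed
  also have "\<dots> = (q + 1) ^ 4 - 4 * (q + 1)\<^sup>2 * (a\<^sup>2 + b\<^sup>2) + 16 * (a * b)\<^sup>2"
    by algebra
  also have "\<dots> = q ^ 4 + (3 + 4 * q + 16 * (a * b)\<^sup>2)"
    unfolding ab by (simp add: power2_eq_square power4_eq_xxxx algebra_simps)
  finally have "((a + 1)\<^sup>2 + b\<^sup>2 + 1 / 2) * ((a - 1)\<^sup>2 + b\<^sup>2 + 1 / 2) * (a\<^sup>2 + (b + 1)\<^sup>2 + 1 / 2) * (a\<^sup>2 + (b - 1)\<^sup>2 + 1 / 2)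
    = q ^ 4 + (3 + 4 * q + 16 * (a * b)\<^sup>2)" .
  then have "q ^ 4 \<le> ((a + 1)\<^sup>2 + b\<^sup>2 + 1 / 2) * ((a - 1)\<^sup>2 + b\<^sup>2 + 1 / 2) * (a\<^sup>2 + (b + 1)\<^sup>2 + 1 / 2) * (a\<^sup>2 + (b - 1)\<^sup>2 + 1 / 2)"
    using q by simp
  then have "ln (q ^ 4) \<le> ln (((a + 1)\<^sup>2 + b\<^sup>2 + 1 / 2) * ((a - 1)\<^sup>2 + b\<^sup>2 + 1 / 2) * (a\<^sup>2 + (b + 1)\<^sup>2 + 1 / 2) * (a\<^sup>2 + (b - 1)\<^sup>2 + 1 / 2))"
    using q by (intro ln_mono) auto
  also have "\<dots> = ln ((a + 1)\<^sup>2 + b\<^sup>2 + 1 / 2) + ln ((a - 1)\<^sup>2 + b\<^sup>2 + 1 / 2) + ln (a\<^sup>2 + (b + 1)\<^sup>2 + 1 / 2) + ln (a\<^sup>2 + (b - 1)\<^sup>2 + 1 / 2)"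
    using pos by (simp add: ln_mult)
  finally show ?thesis
    using q by (simp add: sum_nbrs nrm_sq ln_realpow q_def a_def b_def)
qed

lemma profile_inside: "annulus_profile r R h u \<Longrightarrow> x \<in> lball r \<Longrightarrow> u x = h"
  unfolding annulus_profile_def by blast

lemma profile_outside: "annulus_profile r R h u \<Longrightarrow> x \<notin> lball R \<Longrightarrow> u x = 0"
  unfolding annulus_profile_def by blast

lemma profile_harmonic:
  assumes "annulus_profile r R h u" "p \<in> lball R" "p \<notin> lball r"
  shows "(\<Sum>y | adj p y. u y) = 4 * u p"
proof -
  have "u p = (\<Sum>y | adj p y. u y) / 4"
    using assms unfolding annulus_profile_def discrete_harmonic_on_def by blast
  then show ?thesis by simp
qed

lemma profile_nonneg:
  assumes u: "annulus_profile r R h u" and "r < R" "0 \<le> h"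
  shows "0 \<le> u x"
proof (cases "x \<in> lball R - lball r")
  case True
  have "- u x \<le> 0"
  proof (rule discrete_maximum_principle[of "lball R - lball r" "\<lambda>x. - u x", OF _ _ _ True])
    show "4 * - u p \<le> (\<Sum>y | adj p y. - u y)" if "p \<in> lball R - lball r" for p
      using that by (simp add: profile_harmonic[OF u] sum_negf)
    show "- u y \<le> 0" if "y \<notin> lball R - lball r" for y
      using that assms(3) by (cases "y \<in> lball r") (auto simp: profile_inside[OF u] profile_outside[OF u])
  qed (simp add: finite_lball)
  then show ?thesis by simp
next
  case False
  then show ?thesis
    using assms(3) by (cases "x \<in> lball r") (auto simp: profile_inside[OF u] profile_outside[OF u])
qed

lemma profile_le:
  assumes u: "annulus_profile r R h u" and "r < R" "0 \<le> h"
  shows "u x \<le> h"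
proof (cases "x \<in> lball R - lball r")
  case True
  have "u x - h \<le> 0"
  proof (rule discrete_maximum_principle[of "lball R - lball r" "\<lambda>x. u x - h", OF _ _ _ True])
    show "4 * (u p - h) \<le> (\<Sum>y | adj p y. u y - h)" if "p \<in> lball R - lball r" for p
      using that by (simp add: profile_harmonic[OF u] sum_subtractf card_nbrs)
    show "u y - h \<le> 0" if "y \<notin> lball R - lball r" for y
      using that assms(3) by (cases "y \<in> lball r") (auto simp: profile_inside[OF u] profile_outside[OF u])
  qed (simp add: finite_lball)
  then show ?thesis by simp
next
  case False
  then show ?thesis
    using assms(3) by (cases "x \<in> lball r") (auto simp: profile_inside[OF u] profile_outside[OF u])
qed

text \<open>The multiple of \<open>ln ((R + 1)\<^sup>2 + 1 / 2) - ln (\<bar>x\<bar>\<^sup>2 + 1 / 2)\<close> that equals \<open>h\<close> at distance \<open>r\<close> from the origin is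
  superharmonic and dominates \<open>u\<close> on the boundary of the annulus. The radius \<open>R + 1\<close> appears because the sites just
  outside the ball of radius \<open>R\<close> lie within that distance.\<close>
lemma profile_small_at_boundary:
  assumes u: "annulus_profile r R h u" and r: "0 \<le> r" "r + 1 < R" "2 < R" and h: "0 \<le> h"
    and xy: "adj x y" "x \<notin> lball R" "y \<in> lball R"
  shows "u y \<le> h / (ln ((R + 1)\<^sup>2 + 1 / 2) - ln (r\<^sup>2 + 1 / 2)) * (4 / (R - 2))"
proof -
  let ?g = "\<lambda>x. ln ((nrm x)\<^sup>2 + 1 / 2)" and ?c = "\<lambda>s::real. ln (s\<^sup>2 + 1 / 2)"
  define \<mu> where "\<mu> = h / (?c (R + 1) - ?c r)"
  have pos: "0 < s\<^sup>2 + 1 / 2" for s :: real by (simp add: add_nonneg_pos)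
  have c_mono: "?c s \<le> ?c t" if "0 \<le> s" "s \<le> t" for s t
    using that pos by (intro ln_mono) auto
  have "?c r < ?c (R + 1)"
    using r by (subst ln_less_cancel_iff) (auto simp: pos intro: power_strict_mono)
  then have \<mu>: "0 \<le> \<mu>" "\<mu> * (?c (R + 1) - ?c r) = h"
    using h by (auto simp: \<mu>_def)
  have y_large: "R - 1 < nrm y"
    using nrm_adj[OF adj_sym[OF xy(1)]] xy(2) by (simp add: lball_iff)
  then have y: "y \<in> lball R - lball r" using xy r by (auto simp: lball_iff)
  \<comment> \<open>The comparison function may be negative far away, but only its values next to the annulus enter.\<close>
  have main: "u y - \<mu> * (?c (R + 1) - ?g y) \<le> 0"
  proof (rule discrete_maximum_principle[of "lball R - lball r" "\<lambda>x. u x - \<mu> * (?c (R + 1) - ?g x)", OF _ _ _ y])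
    show "4 * (u p - \<mu> * (?c (R + 1) - ?g p)) \<le> (\<Sum>y | adj p y. u y - \<mu> * (?c (R + 1) - ?g y))"
      if p: "p \<in> lball R - lball r" for p
    proof -
      have "\<mu> * (4 * ?g p) \<le> \<mu> * (\<Sum>y | adj p y. ?g y)"
        using log_subharmonic \<mu> by (intro mult_left_mono)
      moreover have "4 * u p = (\<Sum>y | adj p y. u y)"
        using p by (simp add: profile_harmonic[OF u])
      moreover have "(\<Sum>y | adj p y. u y - \<mu> * (?c (R + 1) - ?g y))
          = (\<Sum>y | adj p y. u y) - \<mu> * (4 * ?c (R + 1)) + \<mu> * (\<Sum>y | adj p y. ?g y)"
        by (simp add: sum_nbrs algebra_simps)
      ultimately show ?thesis by (simp add: algebra_simps)
    qed
    show "u w - \<mu> * (?c (R + 1) - ?g w) \<le> 0"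
      if "p \<in> lball R - lball r" "adj p w" "w \<notin> lball R - lball r" for p w
    proof (cases "w \<in> lball r")
      case True
      then have "?g w \<le> ?c r" by (intro c_mono) (auto simp: lball_iff)
      then have "\<mu> * (?c (R + 1) - ?c r) \<le> \<mu> * (?c (R + 1) - ?g w)"
        using \<mu> by (intro mult_left_mono) auto
      then show ?thesis using True \<mu> by (simp add: profile_inside[OF u])
    next
      case False
      then have "u w = 0" using that(3) by (simp add: profile_outside[OF u])
      moreover have "nrm w \<le> R + 1" using nrm_adj[OF that(2)] that(1) by (simp add: lball_iff)
      then have "?g w \<le> ?c (R + 1)" by (intro c_mono) auto
      ultimately show ?thesis using \<mu> by simp
    qed
  qed (simp add: finite_lball)
  have "?c (R + 1) - ?g y \<le> 4 / (R - 2)"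
  proof -
    have "?c (R - 1) \<le> ?g y" using y_large r by (intro c_mono) auto
    then have "?c (R + 1) - ?g y \<le> ln (((R + 1)\<^sup>2 + 1 / 2) / ((R - 1)\<^sup>2 + 1 / 2))"
      using pos[of "R + 1"] pos[of "R - 1"] by (subst ln_divide_pos) linarith+
    also have "\<dots> \<le> ((R + 1)\<^sup>2 + 1 / 2) / ((R - 1)\<^sup>2 + 1 / 2) - 1"
      using pos by (intro ln_le_minus_one) simp
    also have "\<dots> = 4 * R / ((R - 1)\<^sup>2 + 1 / 2)"
      using pos[of "R - 1"] by (simp add: field_simps power2_eq_square)
    also have "\<dots> \<le> 4 / (R - 2)"
      using r pos[of "R - 1"] by (simp add: divide_le_eq pos_le_divide_eq) (simp add: field_simps power2_eq_square)
    finally show ?thesis .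
  qed
  then have "\<mu> * (?c (R + 1) - ?g y) \<le> \<mu> * (4 / (R - 2))"
    using \<mu> by (intro mult_left_mono)
  with main have "u y \<le> \<mu> * (4 / (R - 2))" by linarith
  then show ?thesis by (simp add: \<mu>_def)
qed


lemma discrete_green:
  fixes u :: "site \<Rightarrow> real"
  assumes "finite S"
  shows "(\<Sum>(x, y)\<in>out_edges S. u x - u y) = (\<Sum>x\<in>S. 4 * u x - (\<Sum>y | adj x y. u y))"
proof -
  define g where "g = (\<lambda>(x, y). u x - u y)"
  define I where "I = {(x, y). adj x y \<and> x \<in> S \<and> y \<in> S}"
  have finI: "finite I"
    by (rule finite_subset[of _ "S \<times> S"]) (use assms in \<open>auto simp: I_def\<close>)
  have "(\<Sum>x\<in>S. 4 * u x - (\<Sum>y | adj x y. u y)) = (\<Sum>x\<in>S. \<Sum>y | adj x y. g (x, y))"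
    by (simp add: g_def sum_subtractf card_nbrs)
  also have "\<dots> = sum g (SIGMA x:S. {y. adj x y})"
    by (subst sum.Sigma) (auto simp: assms finite_nbrs)
  also have "(SIGMA x:S. {y. adj x y}) = out_edges S \<union> I"
    by (auto simp: out_edges_def I_def)
  also have "sum g (out_edges S \<union> I) = sum g (out_edges S) + sum g I"
    by (rule sum.union_disjoint[OF finite_out_edges[OF assms] finI]) (auto simp: out_edges_def I_def)
  also have "sum g I = 0"
  proof -
    have "prod.swap ` I = I"
      by (auto simp: I_def image_iff adj_sym)
    then have "sum g I = sum (g \<circ> prod.swap) I"
      using sum.reindex[of prod.swap I g] by simp
    also have "\<dots> = - sum g I"
      unfolding sum_negf[symmetric] by (intro sum.cong) (auto simp: g_def)
    finally show ?thesis by simp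
  qed
  finally show ?thesis by (simp add: g_def)
qed

text \<open>The squared norm along the ray is a convex function of the step, and it increases at the first step.\<close>
lemma ray_leaves_lball:
  assumes "(a, b) \<in> lball R" "(a + d, b + e) \<notin> lball R" "d\<^sup>2 + e\<^sup>2 = 1" "1 \<le> m"
  shows "(a + m * d, b + m * e) \<notin> lball R"
proof
  let ?n = "\<lambda>t. (real_of_int (a + t * d))\<^sup>2 + (real_of_int (b + t * e))\<^sup>2"
  let ?p = "real_of_int (a * d + b * e)"
  assume "(a + m * d, b + m * e) \<in> lball R"
  then have "sqrt (?n m) \<le> R" "sqrt (?n 0) \<le> R" "R < sqrt (?n 1)"
    using assms(1,2) by (simp_all add: lball_def not_le)
  then have "sqrt (?n m) < sqrt (?n 1)" "sqrt (?n 0) < sqrt (?n 1)" by linarith+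
  then have lt: "?n m < ?n 1" "?n 0 < ?n 1" unfolding real_sqrt_less_iff .
  have de: "(real_of_int d)\<^sup>2 + (real_of_int e)\<^sup>2 = 1"
    using assms(3) by (simp flip: of_int_power of_int_add)
  have n: "?n t = ?n 0 + 2 * t * ?p + (real_of_int t)\<^sup>2" for t
  proof -
    have "?n t = ?n 0 + 2 * t * ?p + (real_of_int t)\<^sup>2 * ((real_of_int d)\<^sup>2 + (real_of_int e)\<^sup>2)"
      by (simp add: power2_eq_square algebra_simps)
    then show ?thesis by (simp add: de)
  qed
  have p: "0 < 2 * ?p + 1" using lt(2) n[of 1] by simp
  have "?n m - ?n 1 = (m - 1) * (2 * ?p + 1 + m)"
    using n[of m] n[of 1] by (simp add: power2_eq_square algebra_simps)
  moreover have "0 \<le> (real_of_int m - 1) * (2 * ?p + 1 + m)"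
    using p assms(4) by (intro mult_nonneg_nonneg) auto
  ultimately show False using lt(1) by simp
qed

text \<open>From an edge of \<open>S\<close> that enters the ball, walk backwards along the same line away from the ball. By convexity the
  ray never meets the ball again, and its exit from \<open>S\<close> is a boundary edge outside the ball. The exit determines
  direction and line, and only one site of the ray has its predecessor in the ball.\<close>
lemma exit_edges_injection:
  assumes "finite S"
  shows "card {(x, y). adj x y \<and> x \<in> S \<and> x \<notin> lball R \<and> y \<in> lball R}
    \<le> card {(x, y) \<in> out_edges S. x \<notin> lball R \<and> y \<notin> lball R}" (is "card ?Q \<le> card ?T")
proof -
  let ?ray = "\<lambda>(x :: site) (y :: site) (k :: nat).
    (fst x + int k * (fst x - fst y), snd x + int k * (snd x - snd y))"
  have outside: "?ray x y k \<notin> lball R" if "(x, y) \<in> ?Q" for x y k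
  proof -
    have xy: "adj x y" "x \<notin> lball R" "y \<in> lball R" using that by auto
    have "(fst x - fst y)\<^sup>2 + (snd x - snd y)\<^sup>2 = 1" using xy(1) by (auto simp: adj_iff)
    then have "(fst y + (1 + int k) * (fst x - fst y), snd y + (1 + int k) * (snd x - snd y)) \<notin> lball R"
      using xy by (intro ray_leaves_lball) auto
    then show ?thesis by (simp add: algebra_simps)
  qed
  have "\<exists>k. ?ray x y k \<in> S \<and> ?ray x y (Suc k) \<notin> S" if "(x, y) \<in> ?Q" for x y
  proof -
    have "(fst x, snd x) \<in> S" "(fst x - fst y, snd x - snd y) \<noteq> (0, 0)"
      using that by (auto simp: adj_iff)
    from ray_exit[OF assms this] show ?thesis by auto
  qed
  note ex = this
  define K where "K = (\<lambda>(x, y). SOME k. ?ray x y k \<in> S \<and> ?ray x y (Suc k) \<notin> S)"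
  have K: "?ray x y (K (x, y)) \<in> S \<and> ?ray x y (Suc (K (x, y))) \<notin> S" if "(x, y) \<in> ?Q" for x y
    unfolding K_def prod.case by (rule someI_ex[OF ex[OF that]])
  define G where "G = (\<lambda>(x, y). (?ray x y (K (x, y)), ?ray x y (Suc (K (x, y)))))"
  have "G ` ?Q \<subseteq> ?T"
  proof (rule image_subsetI)
    fix p assume p: "p \<in> ?Q"
    obtain x y where xy: "p = (x, y)" by (cases p) auto
    have "adj (?ray x y k) (?ray x y (Suc k))" for k
      using p unfolding xy by (auto simp: adj_iff algebra_simps)
    then show "G p \<in> ?T"
      using K[of x y] outside[of x y "K (x, y)"] outside[of x y "Suc (K (x, y))"] p
      unfolding xy G_def out_edges_def by simp
  qed
  moreover have "inj_on G ?Q"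
  proof (rule inj_onI)
    fix p p' assume p: "p \<in> ?Q" and p': "p' \<in> ?Q" and eq: "G p = G p'"
    obtain x y x' y' where xy: "p = (x, y)" "p' = (x', y')" by (cases p; cases p') auto
    obtain d e where de: "d = fst x - fst y" "e = snd x - snd y" by blast
    have d': "fst x' - fst y' = d" "snd x' - snd y' = e"
      using eq by (auto simp: G_def xy de algebra_simps)
    have base: "fst x + int (K p) * d = fst x' + int (K p') * d" "snd x + int (K p) * e = snd x' + int (K p') * e"
      using eq d' by (auto simp: G_def xy de)
    have no: False if q: "(v, w) \<in> ?Q" "(v', w') \<in> ?Q" "fst v - fst w = d" "snd v - snd w = e"
      "fst v' - fst w' = d" "snd v' - snd w' = e" "m < n"
      "fst v + int m * d = fst v' + int n * d" "snd v + int m * e = snd v' + int n * e" for v w v' w' m n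
    proof -
      have "?ray v' w' (n - Suc m) = w"
        using q(3-9) by (intro prod_eqI) (auto simp: of_nat_diff algebra_simps)
      then show False using outside[OF q(2), of "n - Suc m"] q(1) by simp
    qed
    have "K p = K p'"
    proof (rule linorder_cases)
      assume "K p < K p'"
      from no[OF p[unfolded xy] p'[unfolded xy] de[symmetric] d' this base] show ?thesis ..
    next
      assume "K p' < K p"
      from no[OF p'[unfolded xy] p[unfolded xy] d' de[symmetric] this base[symmetric]] show ?thesis ..
    qed
    then have "x = x'" using base by (intro prod_eqI) auto
    moreover from this have "y = y'" using d' de by (intro prod_eqI) auto
    ultimately show "p = p'" by (simp add: xy)
  qed
  moreover have "finite ?T"
    by (rule finite_subset[OF _ finite_out_edges[OF assms]]) auto
  ultimately show ?thesis by (intro card_inj_on_le)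
qed

lemma barrier_const:
  assumes "real_of_int \<kappa> \<le> c" "0 \<le> c"
  shows "barrier B \<kappa> {} 0 (\<lambda>_. c)"
  using assms by (simp add: barrier_def)

lemma lball_nbr_in_box:
  assumes "adj x y" "x \<in> lball (real n) \<or> y \<in> lball (real n)"
  shows "x \<in> box (n + 1)"
proof -
  have "nrm x \<le> real (n + 1)"
    using assms nrm_adj[OF adj_sym[OF assms(1)]] by (auto simp: lball_iff)
  then show ?thesis using lball_subset_box[of "n + 1"] by (auto simp: lball_iff)
qed

text \<open>Off the ball of radius \<open>R\<close> the profile vanishes and its Laplacian is nonnegative, so minus the profile is
  superharmonic outside the pinned ball.\<close>
lemma barrier_neg_profile:
  assumes u: "annulus_profile r (real n) (real_of_int \<kappa>) u" and r: "r < real n" and \<kappa>: "0 \<le> \<kappa>"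
  shows "barrier (lball r) (- \<kappa>) (lball (real n)) (n + 1) (\<lambda>x. - u x)"
proof -
  have flow: "0 \<le> (\<Sum>(x, y)\<in>out_edges S. (- u x) - (- u y))" if S: "finite S" "S \<inter> lball r = {}" for S
    unfolding discrete_green[OF S(1)]
  proof (rule sum_nonneg)
    fix x assume x: "x \<in> S"
    show "0 \<le> 4 * - u x - (\<Sum>y | adj x y. - u y)"
    proof (cases "x \<in> lball (real n)")
      case True
      then have "(\<Sum>y | adj x y. u y) = 4 * u x"
        using x S by (intro profile_harmonic[OF u]) auto
      then show ?thesis by (simp add: sum_negf)
    next
      case False
      have "0 \<le> (\<Sum>y | adj x y. u y)"
        using profile_nonneg[OF u r] \<kappa> by (intro sum_nonneg) simp
      then show ?thesis by (simp add: sum_negf profile_outside[OF u False])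
    qed
  qed
  have flux: "- (1 / 2) * real c \<le> 2 * (\<Sum>(x, y)\<in>out_edges S. (- u x) - (- u y))"
    if "finite S" "S \<inter> lball r = {}" for S and c :: nat
  proof -
    have "- (1 / 2) * real c \<le> 0" by simp
    with flow[OF that] show ?thesis by linarith
  qed
  have out: "u x = 0" if "x \<notin> box (n + 1)" for x
  proof (rule profile_outside[OF u])
    show "x \<notin> lball (real n)"
      using that lball_subset_box[of n] by (auto simp: box_def)
  qed
  show ?thesis
    unfolding barrier_def
    using flux out lball_nbr_in_box by (auto simp: profile_inside[OF u] profile_outside[OF u])
qed

text \<open>The negative flux comes only from edges between a site outside the ball, where \<open>u\<close> is \<open>0\<close>, and a neighbour
  inside, where \<open>u\<close> is at most \<open>1 / 4\<close>.\<close>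
lemma barrier_profile:
  assumes u: "annulus_profile r (real n) (real_of_int \<kappa>) u" and r: "r < real n" and \<kappa>: "0 \<le> \<kappa>"
    and small: "\<And>x y. adj x y \<Longrightarrow> x \<notin> lball (real n) \<Longrightarrow> y \<in> lball (real n) \<Longrightarrow> u y \<le> 1 / 4"
  shows "barrier (lball r) \<kappa> (lball (real n)) (n + 1) u"
proof -
  let ?D = "lball (real n)"
  have flux: "- (1 / 2) * real (card {(x, y) \<in> out_edges S. x \<notin> ?D \<and> y \<notin> ?D}) \<le> 2 * (\<Sum>(x, y)\<in>out_edges S. u x - u y)"
    if S: "finite S" "S \<inter> lball r = {}" for S
  proof -
    let ?c = "\<lambda>x. card {y. adj x y \<and> x \<notin> ?D \<and> y \<in> ?D}"
    have "- (1 / 4) * real (?c x) \<le> 4 * u x - (\<Sum>y | adj x y. u y)" if x: "x \<in> S" for x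
    proof (cases "x \<in> ?D")
      case True
      then have "(\<Sum>y | adj x y. u y) = 4 * u x"
        using x S by (intro profile_harmonic[OF u]) auto
      then show ?thesis by simp
    next
      case False
      have "(\<Sum>y | adj x y. u y) = (\<Sum>y\<in>{y. adj x y \<and> x \<notin> ?D \<and> y \<in> ?D}. u y)"
        using False by (intro sum.mono_neutral_right finite_nbrs) (auto simp: profile_outside[OF u])
      also have "\<dots> \<le> (\<Sum>y\<in>{y. adj x y \<and> x \<notin> ?D \<and> y \<in> ?D}. 1 / 4)"
        by (intro sum_mono small[of x]) auto
      finally show ?thesis by (simp add: profile_outside[OF u False])
    qed
    then have "(\<Sum>x\<in>S. - (1 / 4) * real (?c x)) \<le> (\<Sum>(x, y)\<in>out_edges S. u x - u y)"
      unfolding discrete_green[OF S(1)] by (rule sum_mono)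
    moreover have "(\<Sum>x\<in>S. - (1 / 4) * real (?c x)) = - (1 / 4) * real (\<Sum>x\<in>S. ?c x)"
      by (simp add: sum_distrib_left)
    moreover have "(\<Sum>x\<in>S. ?c x) = card {(x, y). adj x y \<and> x \<in> S \<and> x \<notin> ?D \<and> y \<in> ?D}"
    proof -
      have "{(x, y). adj x y \<and> x \<in> S \<and> x \<notin> ?D \<and> y \<in> ?D} = (SIGMA x:S. {y. adj x y \<and> x \<notin> ?D \<and> y \<in> ?D})"
        by auto
      moreover have "finite {y. adj x y \<and> x \<notin> ?D \<and> y \<in> ?D}" for x
        by (rule finite_subset[OF _ finite_nbrs]) auto
      ultimately show ?thesis using S(1) by (simp add: card_SigmaI)
    qed
    ultimately show ?thesis
      using exit_edges_injection[OF S(1), of "real n"] by simp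
  qed
  show ?thesis
    unfolding barrier_def
    using flux profile_nonneg[OF u r] \<kappa> lball_nbr_in_box
    by (auto simp: profile_inside[OF u] profile_outside[OF u])
qed

lemma radius_bounds:
  assumes "2 \<le> h"
  shows "20 * (real h / ln (real h)) \<le> real_of_int (outer_radius h)"
    "real_of_int (outer_radius h) \<le> 20 * (real h / ln (real h)) + 1"
    "1 \<le> real h / ln (real h)"
proof -
  have "0 < ln (real h)" "ln (real h) \<le> real h"
    using assms by (auto intro: less_imp_le[OF ln_less_self])
  then show "1 \<le> real h / ln (real h)" by simp
qed (auto simp: outer_radius_def le_of_int_ceiling of_int_ceiling_le_add_one)

text \<open>The bound of \<open>profile_small_at_boundary\<close> tends to \<open>1 / 10\<close>: both the coefficient \<open>h / (2 ln R)\<close> of the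
  logarithm and the gradient \<open>4 / R\<close> are evaluated at \<open>R\<close> close to \<open>20 h / ln h\<close>, and \<open>ln R\<close> is asymptotic to
  \<open>ln h\<close>.\<close>
lemma boundary_value_eventually_small:
  assumes "0 \<le> r"
  shows "\<exists>h0. \<forall>h\<ge>h0. \<forall>u. 2 \<le> h \<longrightarrow> annulus_profile r (real_of_int (outer_radius h)) (real h) u \<longrightarrow>
    (\<forall>x y. adj x y \<and> x \<notin> lball (real_of_int (outer_radius h)) \<and> y \<in> lball (real_of_int (outer_radius h))
      \<longrightarrow> u y \<le> 1 / 4)"
proof -
  let ?c = "ln (r\<^sup>2 + 1 / 2)"
  have "eventually (\<lambda>h::real. r + 2 < 20 * h / ln h \<and> ?c < 2 * ln (20 * h / ln h) \<and>
      h / (2 * ln (20 * h / ln h) - ?c) * (4 / (20 * h / ln h - 2)) \<le> 1 / 4) at_top"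
    by (intro eventually_conj; real_asymp)
  then have "eventually (\<lambda>h::nat. r + 2 < 20 * real h / ln (real h) \<and> ?c < 2 * ln (20 * real h / ln (real h)) \<and>
      real h / (2 * ln (20 * real h / ln (real h)) - ?c) * (4 / (20 * real h / ln (real h) - 2)) \<le> 1 / 4) sequentially"
    by (rule eventually_compose_filterlim[OF _ filterlim_real_sequentially])
  then obtain h0 where h0: "\<And>h. h0 \<le> h \<Longrightarrow> r + 2 < 20 * real h / ln (real h) \<and> ?c < 2 * ln (20 * real h / ln (real h)) \<and>
      real h / (2 * ln (20 * real h / ln (real h)) - ?c) * (4 / (20 * real h / ln (real h) - 2)) \<le> 1 / 4"
    unfolding eventually_sequentially by blast
  show ?thesis
  proof (intro exI[of _ h0] allI impI, elim conjE)
    fix h u x y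
    assume h: "h0 \<le> h" "2 \<le> h"
      and u: "annulus_profile r (real_of_int (outer_radius h)) (real h) u"
      and xy: "adj x y" "x \<notin> lball (real_of_int (outer_radius h))" "y \<in> lball (real_of_int (outer_radius h))"
    define R where "R = real_of_int (outer_radius h)"
    define \<rho> where "\<rho> = 20 * real h / ln (real h)"
    have \<rho>: "r + 2 < \<rho>" "?c < 2 * ln \<rho>" "real h / (2 * ln \<rho> - ?c) * (4 / (\<rho> - 2)) \<le> 1 / 4"
      using h0[OF h(1)] by (simp_all add: \<rho>_def)
    have R: "\<rho> \<le> R" using radius_bounds(1)[OF h(2)] by (simp add: \<rho>_def R_def)
    have "2 * ln \<rho> = ln (\<rho>\<^sup>2)" using \<rho> assms by (simp add: ln_realpow)
    also have "\<dots> \<le> ln ((R + 1)\<^sup>2 + 1 / 2)"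
    proof (rule ln_mono)
      have "\<rho>\<^sup>2 \<le> (R + 1)\<^sup>2" using R \<rho> assms by (intro power_mono) auto
      then show "\<rho>\<^sup>2 \<le> (R + 1)\<^sup>2 + 1 / 2" by simp
    qed (use \<rho> assms in auto)
    finally have ln: "2 * ln \<rho> \<le> ln ((R + 1)\<^sup>2 + 1 / 2)" .
    have "u y \<le> real h / (ln ((R + 1)\<^sup>2 + 1 / 2) - ?c) * (4 / (R - 2))"
      using u xy R \<rho> assms unfolding R_def by (intro profile_small_at_boundary) auto
    also have "\<dots> \<le> real h / (2 * ln \<rho> - ?c) * (4 / (\<rho> - 2))"
      using ln R \<rho> assms by (intro mult_mono divide_left_mono) auto
    finally show "u y \<le> 1 / 4" using \<rho>(3) by linarith
  qed
qed

section \<open>Infinite volume\<close>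

lemma open_coordinate: "open {\<phi> :: config. P (\<phi> x)}"
proof -
  have "open ((\<lambda>\<phi> :: config. \<phi> x) -` {k. P k})"
    by (intro open_vimage discrete_topology_class.open_discrete continuous_on_product_coordinates)
  then show ?thesis by (simp add: vimage_def)
qed

lemma closed_coordinate: "closed {\<phi> :: config. P (\<phi> x)}"
proof -
  have "- {\<phi> :: config. P (\<phi> x)} = {\<phi>. \<not> P (\<phi> x)}" by auto
  then show ?thesis unfolding closed_def using open_coordinate[of "\<lambda>k. \<not> P k" x] by simp
qed

lemma clopen_pinned:
  assumes "finite B"
  shows "open (pinned B \<kappa>)" "closed (pinned B \<kappa>)"
proof -
  have eq: "pinned B \<kappa> = (\<Inter>x\<in>B. {\<phi>. \<phi> x = \<kappa>})"
    by (auto simp: pinned_def)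
  show "open (pinned B \<kappa>)"
    unfolding eq using assms by (intro open_INT ballI open_coordinate[of "\<lambda>k. k = \<kappa>"])
  show "closed (pinned B \<kappa>)"
    unfolding eq by (intro closed_INT ballI closed_coordinate[of "\<lambda>k. k = \<kappa>"])
qed

lemma sets_DG_box [simp]: "sets (DG_box \<beta> M) = sets borel"
  by (simp add: DG_box_def)

lemma space_DG_box [simp]: "space (DG_box \<beta> M) = UNIV"
  by (simp add: DG_box_def)

text \<open>The indicator of a clopen set is a bounded continuous test function. Events that depend on finitely many heights
  are clopen, because the heights are integers.\<close>
lemma clopen_measure_limit:
  assumes \<pi>: "DG_infinite_volume \<beta> \<pi>" and A: "open A" "closed A"
  shows "(\<lambda>M. measure (DG_box \<beta> M) A) \<longlonglongrightarrow> measure \<pi> A"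
proof -
  let ?f = "indicator A :: config \<Rightarrow> real"
  have "open (?f -` U)" for U
  proof -
    have "?f -` U = (if 1 \<in> U then A else {}) \<union> (if 0 \<in> U then - A else {})"
    proof (intro set_eqI)
      fix x
      show "x \<in> ?f -` U \<longleftrightarrow> x \<in> (if 1 \<in> U then A else {}) \<union> (if 0 \<in> U then - A else {})"
        by (cases "x \<in> A") auto
    qed
    then show ?thesis using A by (auto intro!: open_Un)
  qed
  then have cont: "continuous_on UNIV ?f"
    by (simp add: continuous_on_open_vimage)
  have "bounded (range ?f)"
    by (rule boundedI[of _ 1]) (auto simp: indicator_def)
  with cont have "(\<lambda>M. \<integral>x. ?f x \<partial>DG_box \<beta> M) \<longlonglongrightarrow> (\<integral>x. ?f x \<partial>\<pi>)"
    using \<pi> unfolding DG_infinite_volume_def weak_limit_def by blast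
  moreover have "space \<pi> = UNIV"
    using \<pi> sets_eq_imp_space_eq[of \<pi> borel] unfolding DG_infinite_volume_def weak_limit_def by simp
  ultimately show ?thesis by simp
qed

text \<open>Testing the weak limit with the constant \<open>1\<close> shows that the finite-volume measures are eventually nonzero and
  finite, so the inequality between masses passes to real-valued measures.\<close>
lemma limit_inequality:
  assumes \<pi>: "DG_infinite_volume \<beta> \<pi>" and A: "open A" "closed A" and Q: "open Q" "closed Q" and c: "0 \<le> c"
    and le: "\<forall>\<^sub>F M in sequentially. box_mass \<beta> M A \<le> ennreal c * box_mass \<beta> M Q"
  shows "measure \<pi> A \<le> c * measure \<pi> Q"
proof -
  have "prob_space \<pi>" "space \<pi> = UNIV"
    using \<pi> sets_eq_imp_space_eq[of \<pi> borel] unfolding DG_infinite_volume_def weak_limit_def by auto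
  then have "measure \<pi> UNIV = 1" using prob_space.prob_space by metis
  then have "(\<lambda>M. measure (DG_box \<beta> M) UNIV) \<longlonglongrightarrow> 1"
    using clopen_measure_limit[OF \<pi>, of UNIV] by simp
  then have "\<forall>\<^sub>F M in sequentially. 0 < measure (DG_box \<beta> M) UNIV"
    by (rule order_tendstoD) simp
  with le have "\<forall>\<^sub>F M in sequentially. measure (DG_box \<beta> M) A \<le> c * measure (DG_box \<beta> M) Q"
  proof eventually_elim
    case (elim M)
    let ?\<mu> = "emeasure (DG_box \<beta> M)"
    have "?\<mu> UNIV \<noteq> \<infinity>" using elim(2) by (auto simp: measure_def)
    moreover have "?\<mu> Q \<le> ?\<mu> UNIV" by (rule emeasure_mono) auto
    ultimately have fin: "?\<mu> Q < top" by (auto simp: less_top[symmetric] top_unique)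
    have "?\<mu> A \<le> ennreal c * ?\<mu> Q"
      using elim(1) A Q by (simp add: emeasure_DG_box)
    then have "enn2real (?\<mu> A) \<le> enn2real (ennreal c * ?\<mu> Q)"
      using fin by (intro enn2real_mono) (auto simp: ennreal_mult_less_top)
    then show ?case using c by (simp add: measure_def enn2real_mult)
  qed
  then show ?thesis
    using tendsto_mult[OF tendsto_const clopen_measure_limit[OF \<pi> Q]] clopen_measure_limit[OF \<pi> A]
    by (intro tendsto_le[OF sequentially_bot]) auto
qed

lemma box_mass_uminus: "box_mass \<beta> M ((\<lambda>\<phi> x. - \<phi> x) -` A) = box_mass \<beta> M A"
proof -
  let ?f = "\<lambda>\<phi>. ennreal (DG_weight \<beta> M \<phi> / DG_partition \<beta> M) * indicator A \<phi>"
  have "DG_energy M (\<lambda>x. - \<phi> x) = DG_energy M \<phi>" for \<phi>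
    unfolding DG_energy_def by (simp add: abs_minus_commute)
  then have "box_mass \<beta> M ((\<lambda>\<phi> x. - \<phi> x) -` A)
      = (\<integral>\<^sup>+\<phi>. ?f (\<lambda>x. - \<phi> x) \<partial>count_space (box_configs M))"
    unfolding box_mass_def by (intro nn_integral_cong) (simp add: DG_weight_def indicator_def)
  also have "\<dots> = (\<integral>\<^sup>+\<phi>. ?f \<phi> \<partial>count_space (box_configs M))"
  proof (rule nn_integral_bij_count_space[of _ _ _ ?f])
    show "bij_betw (\<lambda>\<phi> x. - \<phi> x) (box_configs M) (box_configs M)"
      by (rule bij_betw_byWitness[where f' = "\<lambda>\<phi> x. - \<phi> x"]) (auto simp: box_configs_def)
  qed
  finally show ?thesis by (simp add: box_mass_def)
qed

text \<open>The lower tail is the upper tail of the field \<open>- \<phi>\<close>, which has the same law and is pinned to \<open>- \<kappa>\<close>.\<close>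
lemma deviation_bound:
  assumes \<pi>: "DG_infinite_volume \<beta> \<pi>" and \<beta>: "4 * ln 5184 \<le> \<beta>"
    and B: "finite B" "connected_sites B" "(0, 0) \<in> B"
    and up: "barrier B \<kappa> D N u" "64 * (2 * real N + 1) + real k \<le> b - u z"
    and down: "barrier B (- \<kappa>) D' N' v" "64 * (2 * real N' + 1) + real k \<le> - a - v z"
  shows "measure \<pi> (pinned B \<kappa> \<inter> {\<phi>. real_of_int (\<phi> z) \<notin> {a..b}})
    \<le> 2 * exp (4 * ln 5184 - \<beta>) ^ k * measure \<pi> (pinned B \<kappa>)"
proof -
  let ?\<rho> = "exp (4 * ln 5184 - \<beta>) ^ k"
  let ?U = "pinned B \<kappa> \<inter> {\<phi>. b < real_of_int (\<phi> z)}" and ?L = "pinned B \<kappa> \<inter> {\<phi>. real_of_int (\<phi> z) < a}"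
  note clopen = clopen_pinned[OF B(1)]
    open_coordinate[of "\<lambda>k. b < real_of_int k" z] closed_coordinate[of "\<lambda>k. b < real_of_int k" z]
    open_coordinate[of "\<lambda>k. real_of_int k < a" z] closed_coordinate[of "\<lambda>k. real_of_int k < a" z]
  have U: "measure \<pi> ?U \<le> ?\<rho> * measure \<pi> (pinned B \<kappa>)"
  proof (rule limit_inequality[OF \<pi>])
    have "?U = pinned B \<kappa> \<inter> excess u z (b - u z)" by (simp add: excess_def)
    then show "\<forall>\<^sub>F M in sequentially. box_mass \<beta> M ?U \<le> ennreal ?\<rho> * box_mass \<beta> M (pinned B \<kappa>)"
      using excess_tail[OF \<beta> B(2,3) up(1) _ up(2)]
      by (intro eventually_mono[OF eventually_ge_at_top[of N]]) simp
  qed (use clopen in \<open>auto intro!: open_Int closed_Int\<close>)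
  have L: "measure \<pi> ?L \<le> ?\<rho> * measure \<pi> (pinned B \<kappa>)"
  proof (rule limit_inequality[OF \<pi>])
    have eq: "?L = (\<lambda>\<phi> x. - \<phi> x) -` (pinned B (- \<kappa>) \<inter> excess v z (- a - v z))"
      "pinned B \<kappa> = (\<lambda>\<phi> x. - \<phi> x) -` pinned B (- \<kappa>)"
      by (auto simp: excess_def pinned_def)
    have "box_mass \<beta> M ?L = box_mass \<beta> M (pinned B (- \<kappa>) \<inter> excess v z (- a - v z))" for M
      by (subst eq(1)) (rule box_mass_uminus)
    moreover have "box_mass \<beta> M (pinned B \<kappa>) = box_mass \<beta> M (pinned B (- \<kappa>))" for M
      by (subst eq(2)) (rule box_mass_uminus)
    ultimately show "\<forall>\<^sub>F M in sequentially. box_mass \<beta> M ?L \<le> ennreal ?\<rho> * box_mass \<beta> M (pinned B \<kappa>)"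
      using excess_tail[OF \<beta> B(2,3) down(1) _ down(2)]
      by (intro eventually_mono[OF eventually_ge_at_top[of N']]) simp
  qed (use clopen in \<open>auto intro!: open_Int closed_Int\<close>)
  interpret prob_space \<pi>
    using \<pi> by (simp add: DG_infinite_volume_def weak_limit_def)
  have sets: "sets \<pi> = sets borel"
    using \<pi> by (simp add: DG_infinite_volume_def weak_limit_def)
  have "pinned B \<kappa> \<inter> {\<phi>. real_of_int (\<phi> z) \<notin> {a..b}} = ?L \<union> ?U" by auto
  moreover have "measure \<pi> (?L \<union> ?U) \<le> measure \<pi> ?L + measure \<pi> ?U"
    using clopen by (intro measure_Un_le) (auto simp: sets intro!: borel_open open_Int)
  ultimately show ?thesis using U L by simp
qed

text \<open>The factor \<open>2\<close> for the two tails and the loss from \<open>C'\<close> to \<open>C\<close> are compared at the rate \<open>1 / 5\<close>: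
  \<open>C - C' \<ge> 5\<close> yields one unit of \<open>L \<ge> 1\<close>, which covers \<open>ln 2\<close>.\<close>
lemma exp_rate:
  fixes \<beta> C C' L :: real
  assumes "C' \<le> \<beta>" "C' + 5 \<le> C" "1 \<le> L" "L \<le> real k"
  shows "2 * exp (C' - \<beta>) ^ k \<le> exp (- (1 / 5) * (\<beta> - C) * L)"
proof -
  have "(\<beta> - C') * L \<le> (\<beta> - C') * real k" using assms by (intro mult_left_mono) auto
  moreover have "0 \<le> (\<beta> - C') * L" using assms by simp
  moreover have "5 * L \<le> (C - C') * L" using assms by (intro mult_right_mono) auto
  moreover have "(\<beta> - C) * L = (\<beta> - C') * L - (C - C') * L" by (simp add: algebra_simps)
  ultimately have "1 - (\<beta> - C') * real k \<le> - (1 / 5) * ((\<beta> - C) * L)"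
    using assms(3) by linarith
  moreover have "real k * (C' - \<beta>) = - ((\<beta> - C') * real k)" by (simp add: algebra_simps)
  ultimately have exponent: "1 + real k * (C' - \<beta>) \<le> - (1 / 5) * (\<beta> - C) * L"
    unfolding mult.assoc by linarith
  have "2 * exp (C' - \<beta>) ^ k \<le> exp 1 * exp (real k * (C' - \<beta>))"
    using exp_ge_add_one_self[of 1] by (simp add: exp_of_nat_mult)
  also have "\<dots> = exp (1 + real k * (C' - \<beta>))" by (simp add: exp_add)
  also have "\<dots> \<le> exp (- (1 / 5) * (\<beta> - C) * L)"
    unfolding exp_le_cancel_iff by (rule exponent)
  finally show ?thesis .
qed

theorem proposition3p10:
  fixes r :: real
  assumes "0 \<le> r"
  shows "\<exists>C>0. \<exists>\<beta>\<^sub>0. \<forall>\<beta>\<ge>\<beta>\<^sub>0. \<forall>\<pi>. DG_infinite_volume \<beta> \<pi> \<longrightarrow>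
    (\<forall>(h::nat) \<phi>s z. 2 \<le> h \<longrightarrow> r < real_of_int (outer_radius h) \<longrightarrow>
       annulus_profile r (real_of_int (outer_radius h)) (real h) \<phi>s \<longrightarrow> z \<notin> lball r \<longrightarrow>
       \<P>(\<phi> in \<pi>. real_of_int (\<phi> z) \<notin>
             {\<phi>s z - C * (real h / ln (real h)) .. \<phi>s z + C * (real h / ln (real h))}
           \<bar> \<forall>x\<in>lball r. \<phi> x = int h)
         \<le> exp (- (1 / 5) * (\<beta> - C) * (real h / ln (real h))))"
proof -
  obtain h0 where h0: "\<And>h u x y. h0 \<le> h \<Longrightarrow> 2 \<le> h \<Longrightarrow>
      annulus_profile r (real_of_int (outer_radius h)) (real h) u \<Longrightarrow> adj x y \<Longrightarrow>
      x \<notin> lball (real_of_int (outer_radius h)) \<Longrightarrow> y \<in> lball (real_of_int (outer_radius h)) \<Longrightarrow> u y \<le> 1 / 4"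
    using boundary_value_eventually_small[OF assms] by blast
  define C' :: real where "C' = 4 * ln 5184"
  \<comment> \<open>Peeling starts at excess \<open>64 (2 N + 1)\<close>, where \<open>N \<le> 20 L + 2\<close>, so at most at
    \<open>2880 L\<close>, and takes off at most \<open>2 L\<close> units; \<open>h0\<close> covers the range of the profile when \<open>h < h0\<close>.\<close>
  define C where "C = C' + 3000 + real h0"
  have C': "0 \<le> C'" by (simp add: C'_def)
  show ?thesis
  proof (intro exI[of _ C] conjI allI impI)
    show "0 < C" using C' by (simp add: C_def)
    fix \<beta> \<pi> h \<phi>s z
    assume "C \<le> \<beta>" and \<pi>: "DG_infinite_volume \<beta> \<pi>" and h: "2 \<le> h"
      and r: "r < real_of_int (outer_radius h)"
      and u: "annulus_profile r (real_of_int (outer_radius h)) (real h) \<phi>s"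
    then have \<beta>: "C' \<le> \<beta>" by (simp add: C_def)
    define L where "L = real h / ln (real h)"
    define k where "k = nat \<lceil>L\<rceil>"
    let ?I = "{\<phi>s z - C * L .. \<phi>s z + C * L}" and ?B = "lball r"
    have L: "1 \<le> L" "real_of_int (outer_radius h) \<le> 20 * L + 1"
      using radius_bounds[OF h] by (simp_all add: L_def)
    have k: "L \<le> real k" "real k \<le> 2 * L"
      using L(1) by (auto simp: k_def) (linarith)
    have B: "finite ?B" "connected_sites ?B" "(0, 0) \<in> ?B"
      using assms by (simp_all add: finite_lball connected_lball lball_iff nrm_def)
    have CL: "3000 * L + real h0 \<le> C * L"
    proof -
      have "(3000 + real h0) * L \<le> C * L" using C' L by (intro mult_right_mono) (auto simp: C_def)
      moreover have "real h0 * 1 \<le> real h0 * L" using L by (intro mult_left_mono) auto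
      ultimately show ?thesis by (simp add: algebra_simps)
    qed
    have bound: "measure \<pi> (pinned ?B (int h) \<inter> {\<phi>. real_of_int (\<phi> z) \<notin> ?I})
      \<le> 2 * exp (C' - \<beta>) ^ k * measure \<pi> (pinned ?B (int h))"
    \<comment> \<open>For small \<open>h\<close> the constants \<open>h\<close> and \<open>0\<close> replace the profile, at a bounded loss.\<close>
    proof (cases "h0 \<le> h")
      case True
      define n where "n = nat (outer_radius h)"
      have n: "real_of_int (outer_radius h) = real n"
        using r assms by (simp add: n_def)
      have u': "annulus_profile r (real n) (real_of_int (int h)) \<phi>s" and r': "r < real n"
        using u r n by simp_all
      have "64 * (2 * real (n + 1) + 1) + real k \<le> C * L"
        using L k CL n by simp
      then show ?thesis
        unfolding C'_def using h0[OF True h u] n \<beta>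
        by (intro deviation_bound[OF \<pi> _ B barrier_profile[OF u' r'] _ barrier_neg_profile[OF u' r']])
          (auto simp: C'_def)
    next
      case False
      then have "0 \<le> \<phi>s z" "\<phi>s z \<le> real h" "real h \<le> real h0"
        using profile_nonneg[OF u r] profile_le[OF u r] by auto
      then have "64 * (2 * real 0 + 1) + real k \<le> \<phi>s z + C * L - real h"
        "64 * (2 * real 0 + 1) + real k \<le> - (\<phi>s z - C * L) - 0"
        using L k CL by simp_all
      then show ?thesis
        unfolding C'_def using \<beta>
        by (intro deviation_bound[OF \<pi> _ B barrier_const[of _ "real h"] _ barrier_const[of _ 0]])
          (auto simp: C'_def)
    qed
    have rate: "2 * exp (C' - \<beta>) ^ k \<le> exp (- (1 / 5) * (\<beta> - C) * L)"
      using \<beta> L k by (intro exp_rate) (auto simp: C_def)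
    have space: "space \<pi> = UNIV"
      using \<pi> sets_eq_imp_space_eq[of \<pi> borel] by (simp add: DG_infinite_volume_def weak_limit_def)
    have "\<P>(\<phi> in \<pi>. real_of_int (\<phi> z) \<notin> ?I \<bar> \<forall>x\<in>?B. \<phi> x = int h)
      = measure \<pi> (pinned ?B (int h) \<inter> {\<phi>. real_of_int (\<phi> z) \<notin> ?I}) / measure \<pi> (pinned ?B (int h))"
      unfolding cond_prob_def space pinned_def by (intro arg_cong2[where f = divide] arg_cong[where f = "measure \<pi>"]) auto
    also have "\<dots> \<le> 2 * exp (C' - \<beta>) ^ k"
      using bound measure_nonneg[of \<pi> "pinned ?B (int h)"]
      by (cases "measure \<pi> (pinned ?B (int h)) = 0") (auto simp: divide_le_eq)
    finally show "\<P>(\<phi> in \<pi>. real_of_int (\<phi> z) \<notin>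
             {\<phi>s z - C * (real h / ln (real h)) .. \<phi>s z + C * (real h / ln (real h))}
           \<bar> \<forall>x\<in>lball r. \<phi> x = int h) \<le> exp (- (1 / 5) * (\<beta> - C) * (real h / ln (real h)))"
      using rate unfolding L_def by linarith
  qed
qed

end
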